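(* Let $a_1\in\mathbb{Q}\setminus\{0\}$, $b_0\in\mathbb{Q}\setminus\{-1,-2,-3,\dots\}$, $b_1\in\mathbb{Q}$, and let $(s_n)_{n\ge0}$ be a sequence of rational numbers satisfying \[(n+b_0)s_n+(a_1n+b_1)s_{n-1}=0\quad\text{for all } n\ge1.\] Then the generating function $S(x)=\sum_{n\ge0}s_nx^n$ is globally bounded (and algebraic) if and only if one of the following conditions holds: (1) $b_0\in\mathbb{N}$ and $\frac{b_1}{a_1}\notin\mathbb{Z}$; or (2) $b_0\notin\mathbb{Z}$ and $b_0-\frac{b_1}{a_1}\in-\mathbb{N}$; or (3) $b_0\notin\mathbb{Z}$, $b_0-\frac{b_1}{a_1}\notin\mathbb{Z}$ and $\frac{b_1}{a_1}+1\in-\mathbb{N}$; or (4) $b_0,\frac{b_1}{a_1}\in\mathbb{Z}$, $\frac{b_1}{a_1}<0<b_0$ and $\frac{b_1}{a_1}\le-1$; or (5) $b_0,\frac{b_1}{a_1}\in\mathbb{Z}$ and $0<b_0\le\frac{b_1}{a_1}$.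
   Context: $\mathbb{N}=\{0,1,2,\dots\}$ and $-\mathbb{N}=\{0,-1,-2,\dots\}$. A power series $f\in\mathbb{Q}[[x]]$ is algebraic if it is algebraic over $\mathbb{Q}(x)$. A power series $f(x)=\sum_{n\ge0}a_nx^n\in\mathbb{Q}[[x]]$ is almost integral if there exists $C\in\mathbb{Z}\setminus\{0\}$ with $C^na_n\in\mathbb{Z}$ for all $n\ge1$; it is globally bounded if it is almost integral and has a nonzero radius of convergence in $\mathbb{C}$.
   Formalization: Two assumptions are added because the claim fails without them: S is not the zero series, and not both b_0=0 and b_1/a_1 an integer (there none of (1)-(5) holds, yet S is globally bounded and algebraic, e.g. s_n=(-1)^n with a_1=1, b_0=b_1=0). *)

theory Defs
  imports "HOL-Analysis.Analysis" "HOL-Computational_Algebra.Computational_Algebra"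
begin

(* The field Q(x), viewed inside the field Q((x)) of formal Laurent series. *)
definition rational_functions :: "rat fls set" where
  "rational_functions =
     {fps_to_fls (fps_of_poly p) / fps_to_fls (fps_of_poly q) | p q. q \<noteq> 0}"

definition algebraic_fps :: "rat fps \<Rightarrow> bool" where
  "algebraic_fps f \<longleftrightarrow>
     (\<exists>P :: rat fls poly. P \<noteq> 0 \<and> (\<forall>i. coeff P i \<in> rational_functions) \<and>
        poly P (fps_to_fls f) = 0)"

definition almost_integral :: "rat fps \<Rightarrow> bool" where
  "almost_integral f \<longleftrightarrow>
     (\<exists>C :: int. C \<noteq> 0 \<and> (\<forall>n\<ge>1. of_int C ^ n * fps_nth f n \<in> \<int>))"

definition globally_bounded :: "rat fps \<Rightarrow> bool" where
  "globally_bounded f \<longleftrightarrow>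
     almost_integral f \<and> fps_conv_radius (Abs_fps (\<lambda>n. of_rat (fps_nth f n) :: complex)) > 0"

end

theory Submission
  imports Defs "HOL-Number_Theory.Number_Theory"
begin

text \<open>
  Put \<open>\<alpha> = b1 / a1 + 1\<close> and \<open>\<gamma> = b0 + 1\<close>. Then \<open>s n = s 0 * (- a1) ^ n * (\<alpha>)\<^sub>n / (\<gamma>)\<^sub>n\<close> in terms
  of Pochhammer symbols. If \<open>\<alpha>\<close> is a nonpositive integer, the series is a polynomial; if
  \<open>\<alpha> - \<gamma>\<close> is a natural number, the quotient is a polynomial in \<open>n\<close> and the series is rational; if
  \<open>\<gamma>\<close> is a positive integer and \<open>\<alpha>\<close> is not an integer, the series is, up to a shift and a
  polynomial, the binomial series \<open>(1 + a1 x) powr (\<gamma> - \<alpha> - 1)\<close>.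

  In all other cases arbitrarily large primes occur in the denominators. Write \<open>\<alpha> = a / N\<close> and
  \<open>\<gamma> = c / N\<close>. For a power \<open>Q\<close> of a prime not dividing \<open>N\<close>, let \<open>k\<^sub>a < Q\<close> and \<open>k\<^sub>c < Q\<close> be the first
  indices with \<open>Q\<close> dividing \<open>a + k\<^sub>a N\<close> and \<open>c + k\<^sub>c N\<close>; what is needed is \<open>k\<^sub>c < k\<^sub>a\<close>. If
  \<open>\<gamma> - \<alpha>\<close> is a positive integer, or \<open>\<alpha>\<close> is a positive integer and \<open>\<gamma>\<close> is not an integer, this holds
  for every large prime \<open>Q\<close>. If \<open>\<alpha>\<close>, \<open>\<gamma>\<close> and \<open>\<alpha> - \<gamma>\<close> are all nonintegral, then for
  \<open>Q \<equiv> \<epsilon> (mod N)\<close>, \<open>\<epsilon> = 1\<close> or \<open>\<epsilon> = - 1\<close>, the order of \<open>k\<^sub>a\<close> and \<open>k\<^sub>c\<close> is the order of the residues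
  of \<open>\<epsilon> a\<close> and \<open>\<epsilon> c\<close> modulo \<open>N\<close>, so exactly one of the two signs works; with a large prime
  \<open>p \<equiv> - 1 (mod N)\<close> take \<open>Q = p\<close> for the negative sign and \<open>Q = p\<^sup>2\<close> for the positive one.
  Infinitely many primes \<open>p \<equiv> - 1 (mod N)\<close> exist by an argument with powers of Gaussian integers
  that avoids Dirichlet's theorem.
\<close>

section \<open>Primes congruent to -1 modulo N\<close>

text \<open>For nonzero \<open>b\<close>, \<open>gauss_im a b n\<close> is the imaginary part of
  \<open>(a + b i) ^ n\<close> divided by \<open>b\<close>: the Lucas sequence with parameters
  \<open>2 a\<close> and \<open>a\<^sup>2 + b\<^sup>2\<close>, starting with 0 and 1. The recursion
  builds the division in, so all terms are integers.\<close>

fun gauss_re :: "int \<Rightarrow> int \<Rightarrow> nat \<Rightarrow> int" and gauss_im :: "int \<Rightarrow> int \<Rightarrow> nat \<Rightarrow> int" where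
  "gauss_re a b 0 = 1"
| "gauss_re a b (Suc n) = a * gauss_re a b n - b\<^sup>2 * gauss_im a b n"
| "gauss_im a b 0 = 0"
| "gauss_im a b (Suc n) = gauss_re a b n + a * gauss_im a b n"

lemma gauss_power:
  "(of_int a + of_int b * \<i>) ^ n
     = of_int (gauss_re a b n) + of_int (gauss_im a b n) * (of_int b * \<i>)"
  by (induction n) (simp_all add: algebra_simps power2_eq_square)

lemma gauss_add:
  "gauss_re a b (m + n) = gauss_re a b m * gauss_re a b n - b\<^sup>2 * gauss_im a b m * gauss_im a b n"
  "gauss_im a b (m + n) = gauss_re a b m * gauss_im a b n + gauss_im a b m * gauss_re a b n"
proof -
  have "gauss_re a b (m + n) = gauss_re a b m * gauss_re a b n - b\<^sup>2 * gauss_im a b m * gauss_im a b n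
    \<and> gauss_im a b (m + n) = gauss_re a b m * gauss_im a b n + gauss_im a b m * gauss_re a b n"
  proof (induction m)
    case (Suc m)
    then have R: "gauss_re a b (m + n)
        = gauss_re a b m * gauss_re a b n - b\<^sup>2 * gauss_im a b m * gauss_im a b n"
      and U: "gauss_im a b (m + n)
        = gauss_re a b m * gauss_im a b n + gauss_im a b m * gauss_re a b n" by blast+
    show ?case by (simp add: R U algebra_simps)
  qed simp
  then show "gauss_re a b (m + n) = gauss_re a b m * gauss_re a b n - b\<^sup>2 * gauss_im a b m * gauss_im a b n"
    "gauss_im a b (m + n) = gauss_re a b m * gauss_im a b n + gauss_im a b m * gauss_re a b n"
    by simp_all
qed

lemma gauss_norm: "(gauss_re a b n)\<^sup>2 + b\<^sup>2 * (gauss_im a b n)\<^sup>2 = (a\<^sup>2 + b\<^sup>2) ^ n"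
proof (induction n)
  case (Suc n)
  have "(gauss_re a b (Suc n))\<^sup>2 + b\<^sup>2 * (gauss_im a b (Suc n))\<^sup>2
      = (a\<^sup>2 + b\<^sup>2) * ((gauss_re a b n)\<^sup>2 + b\<^sup>2 * (gauss_im a b n)\<^sup>2)"
    by (simp add: power2_eq_square algebra_simps)
  then show ?case using Suc.IH by simp
qed simp

text \<open>With \<open>R\<close> and \<open>U\<close> the components at index \<open>m\<close>,
  expand \<open>(R + U b i) ^ t\<close>: after division by \<open>b\<close> the imaginary part has
  the term \<open>t R ^ (t - 1) U\<close>, and every other term is divisible by
  \<open>U\<^sup>2\<close>.\<close>

lemma gauss_im_mult:
  "\<exists>E. gauss_im a b (m * t) = gauss_im a b m * (int t * gauss_re a b m ^ (t - 1) + gauss_im a b m * E)"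
proof -
  let ?R = "gauss_re a b m" and ?U = "gauss_im a b m"
  have "\<exists>E F. gauss_im a b (m * t) = ?U * (int t * ?R ^ (t - 1) + ?U * E)
            \<and> gauss_re a b (m * t) = ?R ^ t + ?U * F"
  proof (induction t)
    case 0
    show ?case by (intro exI[of _ 0]) simp
  next
    case (Suc t)
    then obtain E F where EF: "gauss_im a b (m * t) = ?U * (int t * ?R ^ (t - 1) + ?U * E)"
      "gauss_re a b (m * t) = ?R ^ t + ?U * F" by blast
    have t: "int t * ?R ^ (t - 1) * ?R = int t * ?R ^ t"
      by (cases t) auto
    have "gauss_im a b (m * Suc t) = ?R * gauss_im a b (m * t) + ?U * gauss_re a b (m * t)"
      by (simp add: gauss_add)
    also have "\<dots> = ?U * (int t * ?R ^ (t - 1) * ?R + ?R ^ t + ?U * (E * ?R + F))"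
      unfolding EF by (simp add: algebra_simps)
    also have "\<dots> = ?U * (int (Suc t) * ?R ^ t + ?U * (E * ?R + F))"
      unfolding t by (simp add: algebra_simps)
    finally have 1: "gauss_im a b (m * Suc t) = ?U * (int (Suc t) * ?R ^ (Suc t - 1) + ?U * (E * ?R + F))"
      by simp
    have "gauss_re a b (m * Suc t) = ?R * gauss_re a b (m * t) - b\<^sup>2 * ?U * gauss_im a b (m * t)"
      by (simp add: gauss_add)
    also have "\<dots> = ?R ^ Suc t + ?U * (?R * F - b\<^sup>2 * gauss_im a b (m * t))"
      unfolding EF(2) by (simp add: algebra_simps)
    finally show ?case using 1 by blast
  qed
  then show ?thesis by blast
qed

text \<open>The part of \<open>(a + b i) ^ n\<close> linear in \<open>b\<close> is
  \<open>n a ^ (n - 1) b i\<close>; the other imaginary terms keep a factor \<open>b\<close> after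
  division by \<open>b\<close>.\<close>

lemma gauss_im_cong: "[gauss_im a b n = int n * a ^ (n - 1)] (mod b)"
proof -
  have "\<exists>E F. gauss_im a b n = int n * a ^ (n - 1) + b * E \<and> gauss_re a b n = a ^ n + b * F"
  proof (induction n)
    case 0
    show ?case by (intro exI[of _ 0]) simp
  next
    case (Suc n)
    then obtain E F where EF: "gauss_im a b n = int n * a ^ (n - 1) + b * E"
      "gauss_re a b n = a ^ n + b * F" by blast
    have n: "a * (int n * a ^ (n - 1)) = int n * a ^ n"
      by (cases n) auto
    have "gauss_im a b (Suc n) = a ^ n + a * (int n * a ^ (n - 1)) + b * (F + a * E)"
      using EF by (simp add: algebra_simps)
    also have "\<dots> = int (Suc n) * a ^ (Suc n - 1) + b * (F + a * E)"
      unfolding n by (simp add: algebra_simps)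
    finally have 1: "gauss_im a b (Suc n) = int (Suc n) * a ^ (Suc n - 1) + b * (F + a * E)" .
    have "gauss_re a b (Suc n) = a ^ Suc n + b * (a * F - b * gauss_im a b n)"
      using EF(2) by (simp add: algebra_simps power2_eq_square)
    then show ?case using 1 by blast
  qed
  then show ?thesis
    by (auto simp: cong_iff_dvd_diff)
qed

text \<open>\<open>a + b i\<close> has trace \<open>2 a\<close>; modulo its norm the second-order
  recurrence collapses to multiplication by \<open>2 a\<close>.\<close>

lemma gauss_im_mod_norm: "[gauss_im a b (Suc n) = (2 * a) ^ n] (mod (a\<^sup>2 + b\<^sup>2))"
proof (induction n)
  case (Suc n)
  have "gauss_im a b (Suc (Suc n)) = 2 * a * gauss_im a b (Suc n) - (a\<^sup>2 + b\<^sup>2) * gauss_im a b n"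
    by (simp add: algebra_simps power2_eq_square)
  then have "[gauss_im a b (Suc (Suc n)) = 2 * a * gauss_im a b (Suc n)] (mod (a\<^sup>2 + b\<^sup>2))"
    by (auto simp: cong_iff_dvd_diff)
  also have "[2 * a * gauss_im a b (Suc n) = 2 * a * (2 * a) ^ n] (mod (a\<^sup>2 + b\<^sup>2))"
    using Suc by (intro cong_mult) auto
  finally show ?case by simp
qed simp

text \<open>If \<open>p\<close> divides \<open>b\<close>, the term is \<open>n a ^ (n - 1)\<close>
  modulo \<open>p\<close>; if \<open>p\<close> divides the norm, it is
  \<open>(2 a) ^ (n - 1)\<close>. Either way \<open>p\<close> would divide both \<open>a\<close> and
  \<open>b\<close>.\<close>

lemma prime_gauss_im_not_dvd:
  fixes p :: int
  assumes p: "prime p" "odd p" and ab: "coprime a b" and "p dvd gauss_im a b n" "\<not> p dvd int n"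
  shows "\<not> p dvd b" "\<not> p dvd a\<^sup>2 + b\<^sup>2"
proof -
  have n: "n \<noteq> 0" using assms by (intro notI) auto
  have nab: "\<not> (p dvd a \<and> p dvd b)"
    using ab p(1) by (metis coprime_common_divisor not_prime_unit)
  show "\<not> p dvd b"
  proof
    assume "p dvd b"
    then have "[gauss_im a b n = int n * a ^ (n - 1)] (mod p)"
      using gauss_im_cong cong_dvd_modulus by blast
    then have "p dvd int n * a ^ (n - 1)"
      using assms(4) cong_dvd_iff by blast
    then have "p dvd a"
      using assms(5) p(1) by (metis prime_dvd_mult_iff prime_dvd_power)
    with \<open>p dvd b\<close> nab show False by blast
  qed
  show "\<not> p dvd a\<^sup>2 + b\<^sup>2"
  proof
    assume Q: "p dvd a\<^sup>2 + b\<^sup>2"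
    then have "[gauss_im a b (Suc (n - 1)) = (2 * a) ^ (n - 1)] (mod p)"
      using gauss_im_mod_norm cong_dvd_modulus by blast
    then have "p dvd (2 * a) ^ (n - 1)"
      using assms(4) n cong_dvd_iff by fastforce
    then have "p dvd 2 * a" using p(1) prime_dvd_power by blast
    moreover have "\<not> p dvd 2"
      using p by (metis dvd_refl primes_dvd_imp_eq two_is_prime_nat prime_int_numeral_eq)
    ultimately have "p dvd a" using p(1) prime_dvd_mult_iff by blast
    moreover from this Q have "p dvd b\<^sup>2"
      by (metis dvd_add_right_iff dvd_power_same dvd_trans dvd_power pos2)
    then have "p dvd b" using p(1) prime_dvd_power by blast
    ultimately show False using nab by blast
  qed
qed

lemma gauss_re_not_dvd:
  fixes p :: int
  assumes "prime p" "\<not> p dvd a\<^sup>2 + b\<^sup>2" "p dvd gauss_im a b m"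
  shows "\<not> p dvd gauss_re a b m"
proof
  assume "p dvd gauss_re a b m"
  then have "p dvd (gauss_re a b m)\<^sup>2 + b\<^sup>2 * (gauss_im a b m)\<^sup>2"
    using assms(3) by (simp add: power2_eq_square)
  then show False using assms(1,2) by (simp add: gauss_norm prime_dvd_power_iff) (metis prime_dvd_power)
qed

text \<open>\<open>r\<close> is the rank of apparition, the least positive index of a multiple of
  \<open>p\<close>. By the addition law, raising the index by \<open>r\<close> multiplies
  \<open>gauss_im\<close> modulo \<open>p\<close> by the unit \<open>gauss_re a b r\<close>, so the
  zeros modulo \<open>p\<close> are periodic.\<close>

lemma gauss_im_rank:
  fixes p :: int
  assumes p: "prime p" "\<not> p dvd a\<^sup>2 + b\<^sup>2" and N: "p dvd gauss_im a b N" "N > 0"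
  obtains r where "\<And>n. p dvd gauss_im a b n \<longleftrightarrow> r dvd n"
proof -
  define r where "r = (LEAST r. r > 0 \<and> p dvd gauss_im a b r)"
  have r: "r > 0" "p dvd gauss_im a b r"
    using LeastI[of "\<lambda>r. r > 0 \<and> p dvd gauss_im a b r" N] N unfolding r_def by auto
  have step: "p dvd gauss_im a b (r + n) \<longleftrightarrow> p dvd gauss_im a b n" for n
    using r(2) gauss_re_not_dvd[OF p r(2)] p(1)
    by (simp add: gauss_add prime_dvd_mult_iff dvd_add_left_iff)
  have mult: "p dvd gauss_im a b (r * q + n) \<longleftrightarrow> p dvd gauss_im a b n" for q n
    by (induction q) (simp_all add: add.assoc step)
  have "p dvd gauss_im a b n \<longleftrightarrow> r dvd n" for n
  proof -
    have "p dvd gauss_im a b n \<longleftrightarrow> p dvd gauss_im a b (n mod r)"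
      using mult[of "n div r" "n mod r"] by simp
    also have "\<dots> \<longleftrightarrow> n mod r = 0"
    proof
      assume "p dvd gauss_im a b (n mod r)"
      then show "n mod r = 0"
        using not_less_Least[of "n mod r" "\<lambda>r. r > 0 \<and> p dvd gauss_im a b r"] r(1)
        unfolding r_def[symmetric] by auto
    qed simp
    finally show ?thesis by (simp add: mod_eq_0_iff_dvd)
  qed
  then show thesis by (rule that)
qed

text \<open>Exponent lifting for \<open>N = m t\<close> with \<open>p\<close> prime to
  \<open>t\<close>: the cofactor from \<open>gauss_im_mult\<close> is \<open>t R ^ (t - 1)\<close>
  modulo \<open>p\<close>, a unit.\<close>

lemma multiplicity_gauss_im:
  fixes p :: int
  assumes p: "prime p" "\<not> p dvd a\<^sup>2 + b\<^sup>2" and m: "p dvd gauss_im a b m"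
    and N: "m dvd N" "\<not> p dvd int N" and nz: "gauss_im a b N \<noteq> 0"
  shows "multiplicity p (gauss_im a b N) = multiplicity p (gauss_im a b m)"
proof -
  from N obtain t where t: "N = m * t" by (elim dvdE)
  obtain E where E: "gauss_im a b N
      = gauss_im a b m * (int t * gauss_re a b m ^ (t - 1) + gauss_im a b m * E)"
    using gauss_im_mult[of a b m t] t by auto
  let ?c = "int t * gauss_re a b m ^ (t - 1) + gauss_im a b m * E"
  have "\<not> p dvd int t" using N t by auto
  then have "\<not> p dvd int t * gauss_re a b m ^ (t - 1)"
    using gauss_re_not_dvd[OF p m] p(1) by (metis prime_dvd_mult_iff prime_dvd_power)
  then have "\<not> p dvd ?c" using m by (simp add: dvd_add_left_iff)
  then have "multiplicity p ?c = 0" by (rule not_dvd_imp_multiplicity_0)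
  then show ?thesis using nz p(1) unfolding E
    by (subst prime_elem_multiplicity_mult_distrib) auto
qed


lemma fermat_theorem_int_odd:
  fixes a :: int
  assumes p: "prime p" "odd p" and a: "\<not> int p dvd a"
  shows "[a ^ (p - 1) = 1] (mod int p)"
proof -
  have "\<not> p dvd nat \<bar>a\<bar>" using a by (simp add: int_dvd_int_iff[symmetric])
  then have "[nat \<bar>a\<bar> ^ (p - 1) = 1] (mod p)" by (rule fermat_theorem[OF p(1)])
  then have "[int (nat \<bar>a\<bar> ^ (p - 1)) = int 1] (mod int p)" by (simp only: cong_int_iff)
  \<comment> \<open>The even exponent makes the passage to \<open>nat \<bar>a\<bar>\<close>
    harmless.\<close>
  moreover have "even (p - 1)" using p(2) by simp
  ultimately show ?thesis by (simp add: power_even_abs)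
qed

text \<open>
  Modulo a prime \<open>p \<equiv> 3 (mod 4)\<close> the Frobenius map is complex conjugation, so
  \<open>(a + b i) ^ (p + 1)\<close> is congruent to the real number \<open>a\<^sup>2 + b\<^sup>2\<close>.
\<close>
lemma prime_dvd_gauss_im_Suc:
  assumes p: "prime p" "p mod 4 = 3" and b: "\<not> int p dvd b"
  shows "int p dvd gauss_im a b (p + 1)"
proof -
  have odd: "odd p" using p(2) by presburger
  have b0: "b \<noteq> 0" using b by auto
  define w :: complex where "w = of_int b * \<i>"
  have w: "w ^ j = of_int (gauss_re 0 b j) + of_int (gauss_im 0 b j) * w" for j
    using gauss_power[of 0 b j] by (simp add: w_def)
  \<comment> \<open>\<open>X\<close> and \<open>Y\<close> collect the middle binomial terms with a
    factor \<open>p\<close> taken out, split into the coefficients of \<open>1\<close> and of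
    \<open>w\<close>.\<close>
  define X where "X = (\<Sum>k\<in>{1..p-1}. int ((p choose k) div p) * a ^ k * gauss_re 0 b (p - k))"
  define Y where "Y = (\<Sum>k\<in>{1..p-1}. int ((p choose k) div p) * a ^ k * gauss_im 0 b (p - k))"
  have p1: "p \<ge> 2" using p(1) prime_ge_2_nat by blast
  have ch: "of_nat (p choose k) = (of_nat p * of_nat ((p choose k) div p) :: complex)"
    if "k \<in> {1..p-1}" for k
  proof -
    have "p dvd (p choose k)" using that p1 p(1) by (intro dvd_choose_prime) auto
    then show ?thesis by (metis dvd_mult_div_cancel of_nat_mult)
  qed
  have "(of_int a + w) ^ p = (\<Sum>k\<le>p. of_nat (p choose k) * of_int a ^ k * w ^ (p - k))"
    by (rule binomial_ring)
  also have "{..p} = insert 0 (insert p {1..p-1})" using p1 by auto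
  also have "(\<Sum>k\<in>\<dots>. of_nat (p choose k) * of_int a ^ k * w ^ (p - k))
      = w ^ p + of_int a ^ p + (\<Sum>k\<in>{1..p-1}. of_nat (p choose k) * of_int a ^ k * w ^ (p - k))"
    using p1 by (subst sum.insert; auto)+
  also have "(\<Sum>k\<in>{1..p-1}. of_nat (p choose k) * of_int a ^ k * w ^ (p - k))
      = (\<Sum>k\<in>{1..p-1}. of_nat p * of_nat ((p choose k) div p) * of_int a ^ k
           * (of_int (gauss_re 0 b (p - k)) + of_int (gauss_im 0 b (p - k)) * w))"
    by (intro sum.cong refl) (simp only: ch w)
  also have "\<dots> = of_nat p * (of_int X + of_int Y * w)"
    by (simp add: X_def Y_def sum_distrib_left sum_distrib_right sum.distrib algebra_simps)
  finally have 1: "(of_int a + w) ^ p = w ^ p + of_int a ^ p + of_nat p * (of_int X + of_int Y * w)" .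
  \<comment> \<open>\<open>p\<close> is written as \<open>2 (2 k + 1) + 1\<close>: the odd power of
    \<open>w\<^sup>2 = - b\<^sup>2\<close> is where \<open>p \<equiv> 3 (mod 4)\<close> yields the
    sign of complex conjugation.\<close>
  obtain k where k: "p = Suc (2 * Suc (2 * k))"
  proof
    show "p = Suc (2 * Suc (2 * (p div 4)))" using p(2) by presburger
  qed
  have "w ^ p = w * (w\<^sup>2) ^ Suc (2 * k)" unfolding k by (simp only: power_Suc power_mult)
  also have "w\<^sup>2 = - (of_int b)\<^sup>2" by (simp add: w_def power_mult_distrib)
  also have "(- (of_int b :: complex)\<^sup>2) ^ Suc (2 * k) = - ((of_int b)\<^sup>2 ^ Suc (2 * k))"
    by (rule power_minus_odd) simp
  also have "(of_int b :: complex)\<^sup>2 ^ Suc (2 * k) = of_int (b ^ (p - 1))"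
    unfolding k by (simp only: power_mult[symmetric] diff_Suc_1 of_int_power)
  finally have 2: "w ^ p = - (w * of_int (b ^ (p - 1)))" by simp
  have 3: "of_int (gauss_re a b p) + of_int (gauss_im a b p) * w
      = of_int (a ^ p + int p * X) + of_int (int p * Y - b ^ (p - 1)) * w"
    using gauss_power[of a b p] 1 2 by (simp add: w_def algebra_simps)
  have "Re (of_int (gauss_re a b p) + of_int (gauss_im a b p) * w)
      = Re (of_int (a ^ p + int p * X) + of_int (int p * Y - b ^ (p - 1)) * w)"
    "Im (of_int (gauss_re a b p) + of_int (gauss_im a b p) * w)
      = Im (of_int (a ^ p + int p * X) + of_int (int p * Y - b ^ (p - 1)) * w)"
    by (simp_all only: 3)
  then have "real_of_int (gauss_re a b p) = real_of_int (a ^ p + int p * X)"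
    "real_of_int (gauss_im a b p) * b = real_of_int (int p * Y - b ^ (p - 1)) * b"
    by (simp_all add: w_def)
  then have RU: "gauss_re a b p = a ^ p + int p * X" "gauss_im a b p = int p * Y - b ^ (p - 1)"
    using b0 by (simp_all only: of_int_eq_iff mult_cancel_right of_int_0_eq_iff) auto
  have fa: "[a ^ p = a] (mod int p)"
  proof (cases "int p dvd a")
    case True
    moreover from this have "int p dvd a ^ p" using p1 by (simp add: dvd_power dvd_trans)
    ultimately show ?thesis by (simp add: cong_iff_dvd_diff)
  next
    case False
    have "[a ^ (p - 1) * a = 1 * a] (mod int p)"
      by (intro cong_mult fermat_theorem_int_odd p(1) odd False cong_refl)
    then show ?thesis using p1 by (metis One_nat_def Suc_pred mult.commute mult_1 not_numeral_le_zero
          power_Suc zero_less_iff_neq_zero)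
  qed
  have "[gauss_im a b p = - (b ^ (p - 1))] (mod int p)" by (simp add: RU cong_iff_dvd_diff)
  also have "[- (b ^ (p - 1)) = - 1] (mod int p)"
    using fermat_theorem_int_odd[OF p(1) odd b] cong_minus_minus_iff by blast
  finally have U: "[gauss_im a b p = - 1] (mod int p)" .
  have "[gauss_re a b p = a ^ p] (mod int p)" by (simp add: RU cong_iff_dvd_diff)
  then have R: "[gauss_re a b p = a] (mod int p)" using fa cong_trans by blast
  \<comment> \<open>The left side is \<open>gauss_im a b (p + 1)\<close> by the recursion, the right
    side is 0.\<close>
  have "[gauss_re a b p + a * gauss_im a b p = a + a * (- 1)] (mod int p)"
    by (intro cong_add cong_mult R U cong_refl)
  then show ?thesis by (simp add: cong_0_iff)
qed

text \<open>The witness \<open>a + b i\<close> has argument between \<open>\<pi> / N\<close> and \<open>\<pi> / (N - 1)\<close>.\<close>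
lemma exists_gauss_sign_change:
  fixes B N :: nat
  assumes B: "B \<ge> 2" and N: "N \<ge> 4"
  obtains a b :: int where "coprime a b" "[a = 1] (mod int B)" "int B dvd b"
    "\<And>m. 0 < m \<Longrightarrow> m < N \<Longrightarrow> gauss_im a b m > 0" "gauss_im a b N < 0"
proof -
  define x y where "x = pi / N" and "y = pi / (N - 1)"
  have ang: "0 < x" "x < y" "y < pi / 2"
    using N by (auto simp: x_def y_def field_simps intro!: divide_strict_left_mono)
  define t1 t2 where "t1 = tan x" and "t2 = tan y"
  have t: "0 < t1" "t1 < t2"
    unfolding t1_def t2_def using tan_gt_zero[of x] tan_monotone[of x y] ang by linarith+
  \<comment> \<open>The quotient \<open>a / b\<close> has to lie between \<open>inverse t2\<close>
    and \<open>inverse t1\<close>, an interval of length \<open>d\<close>. The choice of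
    \<open>k\<close> makes the interval for \<open>a\<close>, of length \<open>d b\<close>, longer
    than \<open>2 B\<close>.\<close>
  define d where "d = inverse t1 - inverse t2"
  have d: "d > 0" using t by (simp add: d_def)
  obtain k where k: "(1 / real B) ^ k < d / 2"
    using real_arch_pow_inv[of "d / 2" "1 / real B"] d B by auto
  define b :: int where "b = int B ^ (k + 1)"
  \<comment> \<open>This puts \<open>a = 1 + B n\<close> below \<open>inverse t1 * b\<close> and
    within \<open>2 B\<close> of it; the final \<open>- 1\<close> makes the upper bound
    strict.\<close>
  define n where "n = \<lfloor>inverse t1 * real B ^ k - 1 / real B\<rfloor> - 1"
  define a where "a = 1 + int B * n"
  have bpos: "b > 0" using B by (simp add: b_def)
  have "real_of_int n < inverse t1 * real B ^ k - 1 / real B"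
    "real_of_int n \<ge> inverse t1 * real B ^ k - 1 / real B - 2"
    unfolding n_def by linarith+
  then have "B * real_of_int n < B * (inverse t1 * real B ^ k - 1 / real B)"
    "B * real_of_int n \<ge> B * (inverse t1 * real B ^ k - 1 / real B - 2)"
    using B by (auto intro: mult_strict_left_mono mult_left_mono)
  then have "real_of_int a < inverse t1 * b" "real_of_int a \<ge> inverse t1 * b - 2 * B"
    using B by (auto simp: a_def b_def algebra_simps)
  moreover have "2 * B < d * b"
  proof -
    have "2 < d * real B ^ k" using k B by (simp add: field_simps)
    then have "2 * B < d * real B ^ k * B" using B by simp
    then show ?thesis by (simp add: b_def mult_ac)
  qed
  ultimately have ab: "inverse t2 * b < a" "a < inverse t1 * b"
    by (auto simp: d_def algebra_simps)
  then have apos: "real_of_int a > 0"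
    using t bpos by (smt (verit) mult_pos_pos of_int_0_less_iff positive_imp_inverse_positive)
  define \<theta> where "\<theta> = arctan (b / a)"
  have ba: "t1 < b / a" "b / a < t2"
    using ab apos t by (simp_all add: field_simps)
  have "arctan t1 < \<theta>" "\<theta> < arctan t2" unfolding \<theta>_def using ba by (simp_all add: arctan_less_iff)
  moreover have "arctan t1 = x" "arctan t2 = y"
    unfolding t1_def t2_def using arctan_tan[of x] arctan_tan[of y] ang by linarith+
  ultimately have th: "x < \<theta>" "\<theta> < y" by simp_all
  define r where "r = a / cos \<theta>"
  have cos: "cos \<theta> > 0" using th ang by (intro cos_gt_zero_pi) auto
  have r: "r > 0" using cos apos by (simp add: r_def)
  have z: "of_int a + of_int b * \<i> = complex_of_real r * cis \<theta>"
  proof -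
    have "tan \<theta> = b / a" by (simp add: \<theta>_def tan_arctan)
    then have "sin \<theta> / cos \<theta> * a = b" using apos by (simp add: tan_def)
    then show ?thesis using cos by (simp add: complex_eq_iff r_def mult.commute)
  qed
  have im: "real_of_int (gauss_im a b m) * real_of_int b = r ^ m * sin (m * \<theta>)" for m
  proof -
    have "(of_int a + of_int b * \<i>) ^ m = complex_of_real (r ^ m) * cis (m * \<theta>)"
      unfolding z by (simp only: power_mult_distrib Complex.DeMoivre of_real_power)
    then have "Im ((of_int a + of_int b * \<i>) ^ m) = r ^ m * sin (m * \<theta>)"
      by (simp del: of_real_power)
    then show ?thesis unfolding gauss_power by simp
  qed
  show thesis
  proof
    have "coprime a (int B)" unfolding a_def
      by (rule coprimeI) (simp add: dvd_add_left_iff)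
    then show "coprime a b" by (simp add: b_def)
    show "[a = 1] (mod int B)" by (simp add: a_def cong_iff_dvd_diff)
    show "int B dvd b" by (simp add: b_def)
    show "gauss_im a b m > 0" if "0 < m" "m < N" for m
    proof -
      have "m * \<theta> < pi"
      proof -
        have "m * \<theta> \<le> (N - 1) * \<theta>" using that th ang by (intro mult_right_mono) auto
        also have "\<dots> < pi" using th(2) N by (simp add: y_def field_simps)
        finally show ?thesis .
      qed
      moreover have "0 < m * \<theta>" using that th ang by simp
      ultimately have "real_of_int (gauss_im a b m) * real_of_int b > 0"
        unfolding im using r by (simp add: sin_gt_zero)
      then show ?thesis using bpos by (simp add: zero_less_mult_iff)
    qed
    have "pi < N * \<theta>" using th(1) N by (simp add: x_def field_simps)
    \<comment> \<open>From \<open>N \<le> 2 (N - 1)\<close>: the angle has passed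
      \<open>\<pi>\<close> but not yet \<open>2 \<pi>\<close>.\<close>
    moreover have "N * \<theta> < 2 * pi"
    proof -
      have "N * \<theta> < N * (pi / (N - 1))" using th(2) N unfolding y_def by (intro mult_strict_left_mono) auto
      also have "\<dots> \<le> 2 * pi" using N by (simp add: field_simps)
      finally show ?thesis .
    qed
    ultimately have "sin (N * \<theta>) < 0" by (rule sin_lt_zero)
    then have "real_of_int (gauss_im a b N) * real_of_int b < 0" unfolding im using r by (simp add: mult_pos_neg)
    then show "gauss_im a b N < 0" using bpos by (simp add: mult_less_0_iff)
  qed
qed


section \<open>Counting prime factors congruent to 3 modulo 4 by rank of apparition\<close>

text \<open>Odd primes are 1 or -1 modulo 4, so each prime factor 3 modulo 4 contributes one sign
  and the others contribute nothing.\<close>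

lemma odd_cong_parity_prime_factors:
  fixes x :: int
  assumes x: "x > 0" "odd x"
  shows "[x = (- 1) ^ (\<Sum>p | p \<in> prime_factors x \<and> p mod 4 = 3. multiplicity p x)] (mod 4)"
proof -
  have "x = (\<Prod>p\<in>prime_factors x. p ^ multiplicity p x)"
    using prod_prime_factors[of x] x by simp
  also have "[\<dots> = (\<Prod>p\<in>prime_factors x. (if p mod 4 = 3 then - 1 else 1) ^ multiplicity p x)] (mod 4)"
  proof (intro cong_prod cong_pow)
    fix p assume "p \<in> prime_factors x"
    then have "odd p" using x(2) by (meson dvd_trans in_prime_factors_imp_dvd)
    then show "[p = (if p mod 4 = 3 then - 1 else 1)] (mod 4)"
      unfolding cong_def by (auto simp: mod_minus_eq) presburger+
  qed
  also have "(\<Prod>p\<in>prime_factors x. (if p mod 4 = 3 then - 1 else 1) ^ multiplicity p x)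
      = (\<Prod>p\<in>prime_factors x. if p mod 4 = 3 then (- 1 :: int) ^ multiplicity p x else 1)"
    by (intro prod.cong) auto
  also have "\<dots> = (\<Prod>p | p \<in> prime_factors x \<and> p mod 4 = 3. (- 1) ^ multiplicity p x)"
    by (simp add: prod.inter_filter)
  also have "\<dots> = (- 1) ^ (\<Sum>p | p \<in> prime_factors x \<and> p mod 4 = 3. multiplicity p x)"
    by (simp add: power_sum)
  finally show ?thesis .
qed

text \<open>
  Let \<open>u m = U m / m\<close> with \<open>U m = Im ((a + b i) ^ m) / b\<close>. All \<open>u m\<close> with \<open>m\<close> dividing \<open>N\<close>
  are \<open>1 (mod 4)\<close>, and only \<open>u N\<close> is negative. So the number of primes \<open>p \<equiv> 3 (mod 4)\<close>
  in \<open>\<bar>u m\<bar>\<close>, counted with multiplicity, is odd for \<open>m = N\<close> and even for the proper divisors.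
  Grouping these primes by rank of apparition, some such \<open>p\<close> has rank exactly \<open>N\<close>; since \<open>p\<close>
  divides \<open>U (p + 1)\<close>, \<open>N\<close> divides \<open>p + 1\<close>.
\<close>
lemma exists_large_prime_cong_minus_one_aux:
  fixes N M :: nat
  assumes N: "N \<ge> 4"
  shows "\<exists>p. prime p \<and> p > M \<and> N dvd p + 1"
proof -
  \<comment> \<open>In \<open>B\<close>, the factor \<open>N\<close> pays for dividing
    \<open>U m\<close> by \<open>m\<close>, the factor 4 gives
    \<open>u m \<equiv> 1 (mod 4)\<close>, and \<open>K\<close> keeps primes dividing
    \<open>u m\<close> away from \<open>N\<close> and from \<open>fact M\<close>.\<close>
  define K where "K = N * fact M"
  define B where "B = 4 * N * K"
  have K: "K > 0" "N dvd K" "fact M dvd K" using N by (auto simp: K_def)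
  have "B \<ge> 2" using N K(1) by (simp add: B_def)
  then obtain a b :: int where ab: "coprime a b" "[a = 1] (mod int B)" "int B dvd b"
    and pos: "\<And>m. 0 < m \<Longrightarrow> m < N \<Longrightarrow> gauss_im a b m > 0" and neg: "gauss_im a b N < 0"
    using exists_gauss_sign_change N by metis
  define U where "U = gauss_im a b"
  define u where "u m = U m div int m" for m
  have u: "U m = int m * u m" "[u m = 1] (mod (4 * int K))" if m: "m dvd N" for m
  proof -
    obtain l where l: "N = m * l" using m by (elim dvdE)
    then have m0: "m > 0" using N by (intro Nat.gr0I) auto
    have "[U m = int m * a ^ (m - 1)] (mod int B)"
      unfolding U_def using gauss_im_cong ab(3) cong_dvd_modulus by blast
    also have "[int m * a ^ (m - 1) = int m * 1 ^ (m - 1)] (mod int B)"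
      by (intro cong_mult cong_pow ab cong_refl)
    finally obtain c where c: "U m - int m = int B * c"
      by (auto simp: cong_iff_dvd_diff elim: dvdE)
    have "U m = int m * (1 + 4 * int K * (int l * c))"
      using c by (simp add: B_def l algebra_simps)
    then have "u m = 1 + 4 * int K * (int l * c)" using m0 by (simp add: u_def)
    moreover from this have "[u m = 1] (mod (4 * int K))" by (simp add: cong_iff_dvd_diff)
    ultimately show "U m = int m * u m" "[u m = 1] (mod (4 * int K))"
      using \<open>U m = int m * (1 + 4 * int K * (int l * c))\<close> by simp_all
  qed
  have u4: "[u m = 1] (mod 4)" if "m dvd N" for m
    using u(2)[OF that] cong_dvd_modulus dvd_triv_left by blast
  have oddu: "odd (u m)" if "m dvd N" for m
    using u4[OF that] by (auto simp: cong_def) presburger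
  have u0: "u m \<noteq> 0" if "m dvd N" for m using oddu[OF that] by auto
  have pu: "\<not> p dvd int K" if "prime p" "p dvd u m" "m dvd N" for p m
  proof
    assume "p dvd int K"
    then have "[u m = 1] (mod p)" using u(2)[OF that(3)] cong_dvd_modulus dvd_mult by blast
    then have "p dvd 1" using that(2) cong_dvd_iff by blast
    then show False using that(1) not_prime_unit by blast
  qed
  define P where "P = {p \<in> prime_factors (u N). p mod 4 = 3}"
  have finP: "finite P" by (simp add: P_def)
  have P: "prime p" "p dvd U N" "\<not> p dvd int N" "\<not> p dvd int (fact M)" "odd p" "p mod 4 = 3"
    if "p \<in> P" for p
  proof -
    show p: "prime p" "p mod 4 = 3" and "odd p" using that by (auto simp: P_def) presburger
    have pN: "p dvd u N" using that by (auto simp: P_def)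
    then show "p dvd U N" using u(1)[of N] by simp
    show "\<not> p dvd int N" "\<not> p dvd int (fact M)"
      using pu[OF p(1) pN] K(2,3) by (meson dvd_refl dvd_trans int_dvd_int_iff)+
  qed
  have P': "\<not> p dvd b" "\<not> p dvd a\<^sup>2 + b\<^sup>2" if "p \<in> P" for p
    using prime_gauss_im_not_dvd[OF P(1,5)[OF that] ab(1)] P(2,3)[OF that] by (simp_all add: U_def)
  have "\<exists>r. \<forall>n. p dvd U n \<longleftrightarrow> r dvd n" if "p \<in> P" for p
    using gauss_im_rank[OF P(1)[OF that] P'(2)[OF that], of N] P(2)[OF that] N
    unfolding U_def by (metis not_numeral_le_zero zero_less_iff_neq_zero)
  then obtain rk where rk: "\<And>p n. p \<in> P \<Longrightarrow> p dvd U n \<longleftrightarrow> rk p dvd n"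
    by metis
  \<comment> \<open>Since \<open>U m\<close> divides \<open>U N\<close>, no new primes occur in
    \<open>u m\<close>: those of \<open>u N\<close> are merely sorted by rank.\<close>
  have set_eq: "{p \<in> prime_factors (u m). p mod 4 = 3} = {p \<in> P. rk p dvd m}" if m: "m dvd N" for m
  proof (rule Set.set_eqI, rule iffI)
    fix p assume "p \<in> {p \<in> prime_factors (u m). p mod 4 = 3}"
    then have p: "p \<in> prime_factors (u m)" "p mod 4 = 3" by simp_all
    then have pp: "prime p" "p dvd u m" by auto
    have pU: "p dvd U m" using pp(2) u(1)[OF m] by simp
    obtain t where t: "N = m * t" using m by (elim dvdE)
    have "p dvd U N" using gauss_im_mult[of a b m t] pU unfolding t U_def by auto
    moreover have "\<not> p dvd int N" using pu[OF pp m] K(2) by (meson dvd_trans int_dvd_int_iff)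
    ultimately have "p dvd u N" using u(1)[of N] pp(1) by (simp add: prime_dvd_mult_iff)
    then have "p \<in> P" using p pp u0[of N] by (auto simp: P_def in_prime_factors_iff)
    then show "p \<in> {p \<in> P. rk p dvd m}" using rk pU by blast
  next
    fix p assume "p \<in> {p \<in> P. rk p dvd m}"
    then have p: "p \<in> P" "rk p dvd m" by simp_all
    then have "p dvd int m * u m" using rk u(1)[OF m] by metis
    moreover have "\<not> p dvd int m" using P(3)[OF p(1)] m by (meson dvd_trans int_dvd_int_iff)
    ultimately have "p dvd u m" using P(1)[OF p(1)] by (simp add: prime_dvd_mult_iff)
    then show "p \<in> {p \<in> prime_factors (u m). p mod 4 = 3}"
      using P(1,6)[OF p(1)] u0[OF m] by (simp add: in_prime_factors_iff)
  qed
  \<comment> \<open>\<open>p\<close> does not divide \<open>N\<close>, so neither the factor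
    \<open>m\<close> between \<open>u m\<close> and \<open>U m\<close> nor the passage from
    \<open>U m\<close> to \<open>U N\<close> changes the multiplicity.\<close>
  have mult: "multiplicity p (u m) = multiplicity p (U N)"
    if m: "m dvd N" and p: "p \<in> P" "rk p dvd m" for p m
  proof -
    have "\<not> p dvd int m" using P(3)[OF p(1)] m by (meson dvd_trans int_dvd_int_iff)
    then have "multiplicity p (int m) = 0" by (rule not_dvd_imp_multiplicity_0)
    moreover have "m \<noteq> 0" using m N by (intro notI) auto
    ultimately have "multiplicity p (U m) = multiplicity p (u m)"
      unfolding u(1)[OF m] using P(1)[OF p(1)] u0[OF m]
      by (subst prime_elem_multiplicity_mult_distrib) auto
    moreover have "p dvd U m" using p rk by blast
    ultimately show ?thesis
      using multiplicity_gauss_im[OF P(1)[OF p(1)] P'(2)[OF p(1)] _ m P(3)[OF p(1)]] neg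
      unfolding U_def by simp
  qed
  \<comment> \<open>\<open>E\<close> counts the primes whose rank divides \<open>m\<close>,
    \<open>F\<close> those of rank exactly \<open>m\<close>; \<open>E\<close> is the divisor sum of
    \<open>F\<close>.\<close>
  define E where "E m = (\<Sum>p | p \<in> P \<and> rk p dvd m. multiplicity p (U N))" for m
  define F where "F m = (\<Sum>p | p \<in> P \<and> rk p = m. multiplicity p (U N))" for m
  have E: "[\<bar>u m\<bar> = (- 1) ^ E m] (mod 4)" if m: "m dvd N" for m
  proof -
    have "[\<bar>u m\<bar> = (- 1) ^ (\<Sum>p | p \<in> prime_factors \<bar>u m\<bar> \<and> p mod 4 = 3. multiplicity p \<bar>u m\<bar>)] (mod 4)"
      using u0[OF m] oddu[OF m] by (intro odd_cong_parity_prime_factors) auto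
    also have "(\<Sum>p | p \<in> prime_factors \<bar>u m\<bar> \<and> p mod 4 = 3. multiplicity p \<bar>u m\<bar>)
        = (\<Sum>p | p \<in> prime_factors (u m) \<and> p mod 4 = 3. multiplicity p (u m))"
      by (simp add: abs_if)
    also have "\<dots> = E m" unfolding E_def using mult[OF m] set_eq[OF m]
      by (intro sum.cong) auto
    finally show ?thesis .
  qed
  \<comment> \<open>For a proper divisor, \<open>u m\<close> is positive and 1 modulo 4. For
    \<open>N\<close> it is negative, so its absolute value is -1 modulo 4, which forces the odd
    count.\<close>
  have evenE: "even (E m)" if m: "m dvd N" "m < N" for m
  proof (rule ccontr)
    assume "odd (E m)"
    then have "[\<bar>u m\<bar> = - 1] (mod 4)" using E[OF m(1)] by simp
    moreover have "m > 0" using m(1) N by (intro Nat.gr0I notI) auto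
    then have "int m * u m > 0" using pos[of m] m u(1)[OF m(1)] by (simp add: U_def)
    then have "\<bar>u m\<bar> = u m" using \<open>m > 0\<close> by (simp add: zero_less_mult_iff)
    ultimately have "u m mod 4 = 3" "u m mod 4 = 1" using u4[OF m(1)] by (simp_all add: cong_def)
    then show False by simp
  qed
  have oddE: "odd (E N)"
  proof
    assume "even (E N)"
    then have 1: "[\<bar>u N\<bar> = 1] (mod 4)" using E[of N] by simp
    have "int N * u N < 0" using neg u(1)[of N] by (simp add: U_def)
    then have "\<bar>u N\<bar> = - u N" by (simp add: mult_less_0_iff)
    then have "(- u N) mod 4 = 1" "u N mod 4 = 1" using 1 u4[of N] by (simp_all add: cong_def)
    then show False by presburger
  qed
  have EF: "E m = (\<Sum>k | k dvd m. F k)" if "m > 0" for m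
  proof -
    have "(\<Sum>k | k dvd m. \<Sum>p | p \<in> {p \<in> P. rk p dvd m} \<and> rk p = k. multiplicity p (U N)) = E m"
      unfolding E_def using finP that by (intro sum.group) auto
    moreover have "{p. p \<in> {p \<in> P. rk p dvd m} \<and> rk p = k} = {p. p \<in> P \<and> rk p = k}" if "k dvd m" for k
      using that by auto
    ultimately show ?thesis by (simp add: F_def)
  qed
  have split: "E m = F m + (\<Sum>k | k dvd m \<and> k < m. F k)" if "m > 0" for m
  proof -
    have "{k. k dvd m} = insert m {k. k dvd m \<and> k < m}"
      using that by (auto dest: dvd_imp_le)
    then show ?thesis using that by (simp add: EF)
  qed
  \<comment> \<open>Strong induction over divisors takes the place of Moebius inversion modulo
    2.\<close>
  have evenF: "even (F m)" if "m dvd N" "m < N" for m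
    using that
  proof (induction m rule: less_induct)
    case (less m)
    have "even (\<Sum>k | k dvd m \<and> k < m. F k)"
    proof (rule dvd_sum; clarify)
      fix k assume k: "k dvd m" "k < m"
      show "even (F k)" by (rule less.IH) (use k less.prems in \<open>auto intro: dvd_trans\<close>)
    qed
    moreover have "m > 0" using less.prems N by (intro Nat.gr0I) auto
    ultimately show ?case using split[of m] evenE[OF less.prems] by simp
  qed
  have "even (\<Sum>k | k dvd N \<and> k < N. F k)" using evenF by (intro dvd_sum) auto
  then have "odd (F N)" using split[of N] oddE N by simp
  then have "{p. p \<in> P \<and> rk p = N} \<noteq> {}" unfolding F_def by (intro notI) simp
  then obtain q where q: "q \<in> P" "rk q = N" by blast
  define p where "p = nat q"
  have pq: "q = int p" using P(1)[OF q(1)] prime_ge_0_int[of q] by (simp add: p_def)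
  have p: "prime p" "p mod 4 = 3"
    using P(1,6)[OF q(1)] unfolding pq by (simp_all, presburger)
  have "int p dvd U (p + 1)"
    unfolding U_def using prime_dvd_gauss_im_Suc[OF p] P'(1)[OF q(1)] pq by simp
  then have "N dvd p + 1" using rk[OF q(1)] q(2) pq by simp
  moreover have "p > M"
  proof (rule ccontr)
    assume "\<not> p > M"
    then have "p dvd fact M" using p(1) by (simp add: prime_dvd_fact_iff)
    then have "int p dvd int (fact M)" by (simp only: int_dvd_int_iff)
    then show False using P(4)[OF q(1)] pq by blast
  qed
  ultimately show ?thesis using p(1) by blast
qed

lemma exists_large_prime_cong_minus_one:
  fixes N M :: nat
  assumes "N > 0"
  obtains p where "prime p" "p > M" "N dvd p + 1"
proof -
  \<comment> \<open>\<open>4 * N\<close> meets the lower bound 4, and a prime that is -1 modulo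
    \<open>4 * N\<close> is -1 modulo \<open>N\<close>.\<close>
  obtain p where p: "prime p" "p > M" "4 * N dvd p + 1"
    using exists_large_prime_cong_minus_one_aux[of "4 * N" M] assms by auto
  from p(3) have "N dvd p + 1" by (rule dvd_mult_right)
  with p that show thesis by blast
qed

section \<open>Primes in denominators\<close>

text \<open>\<open>C\<close> and the numerators of \<open>\<kappa>\<close> and \<open>\<tau>\<close>
  have finitely many prime divisors. A larger prime in the denominator of the product cannot be
  cancelled by them, and the denominators of \<open>\<kappa>\<close> and \<open>\<tau>\<close> only
  make things worse.\<close>

lemma not_almost_integral:
  fixes X Y :: "nat \<Rightarrow> int" and \<kappa> \<tau> :: rat
  assumes nz: "\<kappa> \<noteq> 0" "\<tau> \<noteq> 0" "\<And>k. X k \<noteq> 0" "\<And>k. Y k \<noteq> 0"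
    and s: "\<And>n. s n = \<kappa> * \<tau> ^ n * (\<Prod>k<n. of_int (X k) / of_int (Y k))"
    and bad: "\<And>M. \<exists>p n. prime p \<and> p > M \<and> n \<ge> 1
      \<and> multiplicity (int p) (\<Prod>k<n. X k) < multiplicity (int p) (\<Prod>k<n. Y k)"
  shows "\<not> almost_integral (Abs_fps s)"
proof
  assume "almost_integral (Abs_fps s)"
  then obtain C :: int where C: "C \<noteq> 0" "\<And>n. n \<ge> 1 \<Longrightarrow> of_int C ^ n * s n \<in> \<int>"
    by (auto simp: almost_integral_def)
  obtain k1 k2 where \<kappa>: "\<kappa> = of_int k1 / of_int k2" "k2 > 0"
    using quotient_of_div surj_pair quotient_of_denom_pos by metis
  obtain t1 t2 where \<tau>: "\<tau> = of_int t1 / of_int t2" "t2 > 0"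
    using quotient_of_div surj_pair quotient_of_denom_pos by metis
  have k1: "k1 \<noteq> 0" and t1: "t1 \<noteq> 0" using nz(1,2) \<kappa> \<tau> by auto
  obtain p n where p: "prime p" "p > nat \<bar>C * k1 * t1\<bar>" "n \<ge> 1"
    and m: "multiplicity (int p) (\<Prod>k<n. X k) < multiplicity (int p) (\<Prod>k<n. Y k)"
    using bad by blast
  define PX PY where "PX = (\<Prod>k<n. X k)" and "PY = (\<Prod>k<n. Y k)"
  have PX: "PX \<noteq> 0" and PY: "PY \<noteq> 0" using nz by (simp_all add: PX_def PY_def)
  obtain z where z: "of_int C ^ n * s n = of_int z" using C(2)[OF p(3)] by (auto elim: Ints_cases)
  have "s n = (of_int k1 / of_int k2) * (of_int t1 / of_int t2) ^ n * (of_int PX / of_int PY)"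
    by (simp add: s \<kappa> \<tau> PX_def PY_def prod_dividef)
  then have sn: "s n * of_int (PY * k2 * t2 ^ n) = of_int (k1 * t1 ^ n * PX)"
    using \<kappa>(2) \<tau>(2) PY by (simp add: power_divide)
  have "of_int (C ^ n * k1 * t1 ^ n * PX) = of_int C ^ n * (of_int (k1 * t1 ^ n * PX) :: rat)"
    by (simp add: mult.assoc)
  also have "\<dots> = of_int z * of_int (PY * k2 * t2 ^ n)"
    unfolding sn[symmetric] z[symmetric] by (simp only: mult.assoc)
  finally have "of_int (C ^ n * k1 * t1 ^ n * PX) = (of_int (z * PY * k2 * t2 ^ n) :: rat)"
    by (simp add: mult.assoc)
  then have eq: "(C ^ n * k1 * t1 ^ n) * PX = (z * k2 * t2 ^ n) * PY"
    by (simp only: of_int_eq_iff mult_ac)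
  have lhs: "(C ^ n * k1 * t1 ^ n) * PX \<noteq> 0" using C(1) k1 t1 PX by simp
  have pp: "prime (int p)" using p(1) by simp
  have "\<not> int p dvd C * k1 * t1"
    using p(2) C(1) k1 t1 dvd_imp_le_int[of "C * k1 * t1" "int p"] by auto
  then have "\<not> int p dvd C ^ n * k1 * t1 ^ n"
    using pp by (metis prime_dvd_mult_iff prime_dvd_power)
  then have "multiplicity (int p) (C ^ n * k1 * t1 ^ n) = 0" by (rule not_dvd_imp_multiplicity_0)
  then have "multiplicity (int p) ((C ^ n * k1 * t1 ^ n) * PX) = multiplicity (int p) PX"
    using lhs pp by (subst prime_elem_multiplicity_mult_distrib) auto
  moreover have "multiplicity (int p) ((z * k2 * t2 ^ n) * PY) \<ge> multiplicity (int p) PY"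
    using lhs unfolding eq by (intro dvd_imp_multiplicity_le) auto
  ultimately show False using m eq by (simp add: PX_def PY_def)
qed

lemma multiplicity_prod_less:
  fixes X Y :: "nat \<Rightarrow> int"
  assumes p: "prime p" and nz: "\<And>k. Y k \<noteq> 0"
    and X: "\<And>k. k < n \<Longrightarrow> \<not> int p dvd X k" and Y: "k < n" "int p dvd Y k"
  shows "multiplicity (int p) (\<Prod>k<n. X k) < multiplicity (int p) (\<Prod>k<n. Y k)"
proof -
  have "\<not> int p dvd (\<Prod>k<n. X k)" using X p by (subst prime_dvd_prod_iff) auto
  then have "multiplicity (int p) (\<Prod>k<n. X k) = 0" by (rule not_dvd_imp_multiplicity_0)
  moreover have "int p dvd (\<Prod>k<n. Y k)" using Y p by (subst prime_dvd_prod_iff) auto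
  then have "multiplicity (int p) (\<Prod>k<n. Y k) > 0"
    using nz p by (simp add: prime_multiplicity_gt_zero_iff)
  ultimately show ?thesis by simp
qed

section \<open>Zeros of an arithmetic progression modulo primes and prime squares\<close>

lemma unique_root_mod:
  fixes N x Q :: int
  assumes Q: "Q > 0" "coprime Q N" and k: "0 \<le> k" "k < Q" "Q dvd x + k * N"
    and k': "0 \<le> k'" "k' < Q" "Q dvd x + k' * N"
  shows "k = k'"
proof -
  have "Q dvd (x + k * N) - (x + k' * N)" using k k' by (intro dvd_diff)
  then have "Q dvd (k - k') * N" by (simp add: algebra_simps)
  then have "Q dvd k - k'" using Q(2) by (simp add: coprime_dvd_mult_left_iff)
  then have "k mod Q = k' mod Q" by (simp add: mod_eq_dvd_iff)
  then show ?thesis using k k' by simp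
qed

lemma exists_root_mod:
  fixes N x Q :: int
  assumes Q: "Q > 0" "coprime Q N"
  obtains k where "0 \<le> k" "k < Q" "Q dvd x + k * N"
proof -
  obtain y where y: "[N * y = 1] (mod Q)"
    using cong_solve_coprime_int[of N Q] Q by (auto simp: coprime_commute)
  define k where "k = (- x * y) mod Q"
  have "[k = - x * y] (mod Q)" by (simp add: k_def cong_def)
  then have "[k * N = - x * y * N] (mod Q)" by (intro cong_mult cong_refl)
  also have "- x * y * N = - x * (N * y)" by simp
  also have "[- x * (N * y) = - x * 1] (mod Q)" by (intro cong_mult y cong_refl)
  finally have "[x + k * N = x + - x * 1] (mod Q)" by (intro cong_add cong_refl)
  then have "Q dvd x + k * N" by (simp add: cong_0_iff)
  moreover have "0 \<le> k" "k < Q" using Q by (simp_all add: k_def)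
  ultimately show thesis using that by blast
qed

text \<open>The zeros modulo \<open>p\<close> form one residue class of \<open>k\<close>, and the
  range consists of \<open>m\<close> full periods.\<close>

lemma card_roots_mod_prime:
  fixes N x :: int
  assumes p: "prime p" "\<not> int p dvd N"
  shows "card {k. k < p * m \<and> int p dvd x + int k * N} = m"
proof -
  have cop: "coprime (int p) N" using p by (intro prime_imp_coprime) auto
  have p0: "int p > 0" "p > 0" using p(1) prime_gt_0_nat by auto
  obtain k0 where k0: "0 \<le> k0" "k0 < int p" "int p dvd x + k0 * N"
    using exists_root_mod[OF p0(1) cop] by blast
  define l where "l = nat k0"
  have l: "l < p" "int p dvd x + int l * N" using k0 by (auto simp: l_def)
  have iff: "int p dvd x + int k * N \<longleftrightarrow> k mod p = l" for k
  proof -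
    have "int p dvd (x + int k * N) - (x + int (k mod p) * N)"
    proof -
      have "(x + int k * N) - (x + int (k mod p) * N) = (int k - int (k mod p)) * N"
        by (simp add: algebra_simps)
      also have "int k - int (k mod p) = int p * int (k div p)"
        by (metis add_diff_cancel_right' mult_div_mod_eq of_nat_add of_nat_mult)
      finally show ?thesis by simp
    qed
    then have "int p dvd x + int k * N \<longleftrightarrow> int p dvd x + int (k mod p) * N"
      by (metis dvd_diff_commute dvd_add_right_iff diff_add_cancel)
    also have "\<dots> \<longleftrightarrow> k mod p = l"
    proof
      assume "int p dvd x + int (k mod p) * N"
      then have "int (k mod p) = int l"
        using unique_root_mod[OF p0(1) cop, of "int (k mod p)" x "int l"] l p0(2) by simp
      then show "k mod p = l" by simp
    qed (use l in simp)
    finally show ?thesis .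
  qed
  have "{k. k < p * m \<and> k mod p = l} = (\<lambda>i. p * i + l) ` {..<m}"
  proof (intro equalityI subsetI)
    fix k assume "k \<in> {k. k < p * m \<and> k mod p = l}"
    then have "k = p * (k div p) + l" "k div p < m"
      using p0 by (auto simp: less_mult_imp_div_less mult.commute)
    then show "k \<in> (\<lambda>i. p * i + l) ` {..<m}" by blast
  next
    fix k assume "k \<in> (\<lambda>i. p * i + l) ` {..<m}"
    then obtain i where i: "k = p * i + l" "i < m" by auto
    have "p * i + l < p * Suc i" using l by simp
    also have "\<dots> \<le> p * m" using i by (intro mult_le_mono2) simp
    finally show "k \<in> {k. k < p * m \<and> k mod p = l}" using i l by simp
  qed
  then show ?thesis using p0 unfolding iff by (simp add: card_image inj_on_def)
qed

text \<open>Over whole periods, divisibility by \<open>p\<close> contributes exactly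
  \<open>m\<close> to both products. Only the second product has a term divisible by
  \<open>p\<^sup>2\<close>, and this breaks the tie.\<close>

lemma multiplicity_prod_less_square:
  fixes a c N :: int and p m :: nat
  assumes p: "prime p" "\<not> int p dvd N" and nz: "\<And>k. a + int k * N \<noteq> 0" "\<And>k. c + int k * N \<noteq> 0"
    and X: "\<And>k. k < p * m \<Longrightarrow> \<not> int p ^ 2 dvd a + int k * N"
    and Y: "k < p * m" "int p ^ 2 dvd c + int k * N"
  shows "multiplicity (int p) (\<Prod>k<p*m. a + int k * N) < multiplicity (int p) (\<Prod>k<p*m. c + int k * N)"
proof -
  have pp: "prime (int p)" using p by simp
  have nu: "\<not> is_unit (int p)" using pp not_prime_unit by blast
  have "multiplicity (int p) (\<Prod>k<p*m. a + int k * N) = (\<Sum>k<p*m. multiplicity (int p) (a + int k * N))"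
    using nz pp by (subst prime_elem_multiplicity_prod_distrib) auto
  also have "\<dots> = (\<Sum>k<p*m. if int p dvd a + int k * N then 1 else 0)"
  proof (intro sum.cong refl)
    fix k assume k: "k \<in> {..<p*m}"
    have "multiplicity (int p) (a + int k * N) < 2"
      using X[of k] k nz(1)[of k] nu by (intro multiplicity_lessI) auto
    moreover have "multiplicity (int p) (a + int k * N) > 0 \<longleftrightarrow> int p dvd a + int k * N"
      using nz(1)[of k] pp by (simp add: prime_multiplicity_gt_zero_iff)
    ultimately show "multiplicity (int p) (a + int k * N) = (if int p dvd a + int k * N then 1 else 0)"
      by (cases "int p dvd a + int k * N") auto
  qed
  also have "\<dots> = m"
    using card_roots_mod_prime[OF p, of m a] by (simp add: sum.If_cases Int_def)
  finally have 1: "multiplicity (int p) (\<Prod>k<p*m. a + int k * N) = m" .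
  have "m = (\<Sum>k<p*m. if int p dvd c + int k * N then 1 else 0)"
    using card_roots_mod_prime[OF p, of m c] by (simp add: sum.If_cases Int_def)
  also have "\<dots> < (\<Sum>k<p*m. multiplicity (int p) (c + int k * N))"
  proof (rule sum_strict_mono_ex1)
    have pos: "multiplicity (int p) (c + int k * N) > 0" if "int p dvd c + int k * N" for k
      using that nz(2)[of k] pp by (simp add: prime_multiplicity_gt_zero_iff)
    show "\<forall>k\<in>{..<p*m}. (if int p dvd c + int k * N then 1 else 0) \<le> multiplicity (int p) (c + int k * N)"
      using pos by (auto simp: Suc_le_eq)
    have "multiplicity (int p) (c + int k * N) \<ge> 2"
      using Y(2) nz(2)[of k] nu by (intro multiplicity_geI) auto
    then show "\<exists>k\<in>{..<p*m}. (if int p dvd c + int k * N then 1 else 0) < multiplicity (int p) (c + int k * N)"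
      using Y(1) by (intro bexI[of _ k]) auto
  qed simp
  also have "\<dots> = multiplicity (int p) (\<Prod>k<p*m. c + int k * N)"
    using nz pp by (subst prime_elem_multiplicity_prod_distrib) auto
  finally show ?thesis using 1 by simp
qed

section \<open>Three families of progressions with arbitrarily large bad primes\<close>

text \<open>If \<open>l\<close> is the root of the first progression modulo \<open>p\<close>, the
  second has the earlier root \<open>l - d\<close>. A prime exceeding the first \<open>d\<close>
  values in absolute value ensures \<open>d \<le> l\<close>.\<close>

lemma bad_primes_shift:
  fixes a N :: int and d M :: nat
  assumes N: "N > 0" and d: "d \<ge> 1" and nz: "\<And>k. a + int k * N \<noteq> 0"
  shows "\<exists>p n. prime p \<and> p > M \<and> n \<ge> 1 \<and> multiplicity (int p) (\<Prod>k<n. a + int k * N)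
      < multiplicity (int p) (\<Prod>k<n. (a + int d * N) + int k * N)"
proof -
  define M' where "M' = M + nat N + (\<Sum>k<d. nat \<bar>a + int k * N\<bar>)"
  obtain p where p: "prime p" "p > M'" using bigger_prime by blast
  have "\<not> int p dvd N" using p(2) N by (auto simp: M'_def dest!: zdvd_imp_le)
  then have cop: "coprime (int p) N" using p by (intro prime_imp_coprime) auto
  have p0: "int p > 0" using p(1) prime_gt_0_nat by auto
  obtain k0 where k0: "0 \<le> k0" "k0 < int p" "int p dvd a + k0 * N"
    using exists_root_mod[OF p0 cop] by blast
  define l where "l = nat k0"
  have l: "int l < int p" "int p dvd a + int l * N" using k0 by (auto simp: l_def)
  have "l \<ge> d"
  proof (rule ccontr)
    assume "\<not> l \<ge> d"
    then have "nat \<bar>a + int l * N\<bar> \<le> (\<Sum>k<d. nat \<bar>a + int k * N\<bar>)"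
      by (intro member_le_sum) auto
    then have "\<bar>a + int l * N\<bar> < int p" using p(2) by (simp add: M'_def)
    then show False using l(2) nz[of l] zdvd_imp_le[of "int p" "\<bar>a + int l * N\<bar>"] by auto
  qed
  have "\<not> int p dvd a + int k * N" if "k < l - d + 1" for k
  proof -
    have "k < l" using that d \<open>l \<ge> d\<close> by linarith
    then show ?thesis using unique_root_mod[OF p0 cop, of "int k" a "int l"] l by auto
  qed
  moreover have "int p dvd (a + int d * N) + int (l - d) * N"
    using l(2) \<open>l \<ge> d\<close> by (simp add: of_nat_diff algebra_simps)
  moreover have "(a + int d * N) + int k * N \<noteq> 0" for k
    using nz[of "d + k"] by (simp add: algebra_simps)
  ultimately have "multiplicity (int p) (\<Prod>k<l-d+1. a + int k * N)
      < multiplicity (int p) (\<Prod>k<l-d+1. (a + int d * N) + int k * N)"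
    by (intro multiplicity_prod_less[OF p(1), of _ _ _ "l - d"]) auto
  then show ?thesis using p by (intro exI[of _ p] exI[of _ "l - d + 1"]) (auto simp: M'_def)
qed

text \<open>The first progression meets \<open>p\<close> first at \<open>p - A\<close>. If the root
  for \<open>c\<close> were not earlier, \<open>p\<close> would divide some \<open>c - i N\<close>
  with \<open>1 \<le> i \<le> A\<close>, which is nonzero and smaller than \<open>p\<close>.\<close>

lemma bad_primes_pos_int:
  fixes c N :: int and A M :: nat
  assumes N: "N > 0" and A: "A \<ge> 1" and c: "\<not> N dvd c"
  shows "\<exists>p n. prime p \<and> p > M \<and> n \<ge> 1 \<and> multiplicity (int p) (\<Prod>k<n. int A * N + int k * N)
      < multiplicity (int p) (\<Prod>k<n. c + int k * N)"
proof -
  define M' where "M' = M + nat N + nat \<bar>c\<bar> + A * nat N + A"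
  obtain p where p: "prime p" "p > M'" using bigger_prime by blast
  have "\<not> int p dvd N" using p(2) N by (auto simp: M'_def dest!: zdvd_imp_le)
  then have cop: "coprime (int p) N" using p by (intro prime_imp_coprime) auto
  have p0: "int p > 0" using p(1) prime_gt_0_nat by auto
  have nz: "c + k * N \<noteq> 0" for k
    using c by (metis add.commute add_diff_cancel_left' diff_0 dvd_minus_iff dvd_triv_right)
  obtain k0 where k0: "0 \<le> k0" "k0 < int p" "int p dvd c + k0 * N"
    using exists_root_mod[OF p0 cop] by blast
  have "k0 < int p - int A"
  proof (rule ccontr)
    assume "\<not> k0 < int p - int A"
    define i where "i = int p - k0"
    have i: "1 \<le> i" "i \<le> int A" using k0 \<open>\<not> k0 < int p - int A\<close> by (auto simp: i_def)
    have "int p dvd c + k0 * N - int p * N" using k0(3) by (intro dvd_diff) auto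
    also have "c + k0 * N - int p * N = c + (- i) * N" by (simp add: i_def algebra_simps)
    finally have "int p \<le> \<bar>c + (- i) * N\<bar>"
      using nz[of "- i"] zdvd_imp_le[of "int p" "\<bar>c + (- i) * N\<bar>"] by auto
    also have "\<dots> \<le> \<bar>c\<bar> + \<bar>(- i) * N\<bar>" by (rule abs_triangle_ineq)
    also have "\<dots> = \<bar>c\<bar> + i * N" using i N by (simp add: abs_mult)
    also have "\<dots> \<le> \<bar>c\<bar> + int A * N" using i N by (intro add_mono mult_right_mono) auto
    also have "\<dots> \<le> int M'" using N by (simp add: M'_def)
    finally show False using p(2) by simp
  qed
  define l where "l = nat k0"
  have l: "int l < int p - int A" "int p dvd c + int l * N"
    using k0 \<open>k0 < int p - int A\<close> by (auto simp: l_def)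
  have "\<not> int p dvd int A * N + int k * N" if "k < l + 1" for k
  proof
    assume "int p dvd int A * N + int k * N"
    then have "int p dvd (int A + int k) * N" by (simp add: algebra_simps)
    then have "int p dvd int A + int k" using cop by (simp add: coprime_dvd_mult_left_iff)
    then have "int p \<le> int A + int k" using A by (intro zdvd_imp_le) auto
    then show False using that l by simp
  qed
  then have "multiplicity (int p) (\<Prod>k<l+1. int A * N + int k * N)
      < multiplicity (int p) (\<Prod>k<l+1. c + int k * N)"
    using l nz by (intro multiplicity_prod_less[OF p(1), of _ _ _ l]) auto
  then show ?thesis using p by (intro exI[of _ p] exI[of _ "l + 1"]) (auto simp: M'_def)
qed

text \<open>For \<open>j = (\<epsilon> * x) mod N\<close> the product \<open>Q j\<close> is
  \<open>x\<close> modulo \<open>N\<close>, so \<open>k = (Q j - x) / N\<close> is the root. It is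
  about \<open>Q j / N\<close>, hence roots are ordered like these residues.\<close>

lemma root_mod_cong_sign:
  fixes N x Q \<epsilon> :: int
  assumes N: "N > 0" and x: "\<not> N dvd x" and \<epsilon>: "\<epsilon> * \<epsilon> = 1" and Q: "[Q = \<epsilon>] (mod N)" "Q > \<bar>x\<bar>"
  obtains k where "0 \<le> k" "k < Q" "x + k * N = Q * ((\<epsilon> * x) mod N)"
proof -
  define j where "j = (\<epsilon> * x) mod N"
  have "\<not> N dvd \<epsilon> * x"
  proof
    assume "N dvd \<epsilon> * x"
    then have "N dvd \<epsilon> * (\<epsilon> * x)" by (rule dvd_mult)
    then show False using x by (simp add: mult.assoc[symmetric] \<epsilon>)
  qed
  then have j: "1 \<le> j" "j \<le> N - 1"
    using pos_mod_bound[OF N, of "\<epsilon> * x"] pos_mod_sign[OF N, of "\<epsilon> * x"]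
    by (auto simp: j_def dvd_eq_mod_eq_0)
  have "[Q * j = \<epsilon> * (\<epsilon> * x)] (mod N)" unfolding j_def by (intro cong_mult Q(1)) simp
  then have "[Q * j = x] (mod N)" by (simp add: mult.assoc[symmetric] \<epsilon>)
  then have "N dvd Q * j - x" by (simp add: cong_iff_dvd_diff)
  then obtain k where k: "Q * j - x = k * N" by (metis dvdE mult.commute)
  have "Q * j \<ge> Q * 1" using j Q(2) by (intro mult_left_mono) auto
  then have "k * N > 0" using k Q(2) by simp
  then have "k \<ge> 0" using N by (simp add: zero_less_mult_iff)
  moreover have "k < Q"
  proof (rule ccontr)
    assume "\<not> k < Q"
    then have "Q * N \<le> k * N" using N by simp
    moreover have "Q * j \<le> Q * (N - 1)" using j Q(2) by (intro mult_left_mono) auto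
    ultimately show False using k Q(2) by (simp add: algebra_simps)
  qed
  moreover have "x + k * N = Q * j" using k by simp
  ultimately show thesis using that unfolding j_def by blast
qed

lemma bad_primes_fractional:
  fixes a c N :: int and M :: nat
  assumes N: "N > 0" and a: "\<not> N dvd a" and c: "\<not> N dvd c" and ac: "\<not> N dvd a - c"
  shows "\<exists>p n. prime p \<and> p > M \<and> n \<ge> 1 \<and> multiplicity (int p) (\<Prod>k<n. a + int k * N)
      < multiplicity (int p) (\<Prod>k<n. c + int k * N)"
proof -
  define M' where "M' = M + nat N + nat \<bar>a\<bar> + nat \<bar>c\<bar>"
  obtain p where p: "prime p" "p > M'" "nat N dvd p + 1"
    using exists_large_prime_cong_minus_one[of "nat N" M'] N by auto
  have "\<not> int p dvd N" using p(2) N by (auto simp: M'_def dest!: zdvd_imp_le)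
  have pp: "prime (int p)" using p(1) by simp
  have cop: "coprime (int p) N" using p \<open>\<not> int p dvd N\<close> by (intro prime_imp_coprime) auto
  have p0: "int p > 0" using p(1) prime_gt_0_nat by auto
  have "N dvd int p + 1" using p(3) N by (metis int_nat_eq int_dvd_int_iff of_nat_1 of_nat_add order_less_imp_le)
  then have pN: "[int p = - 1] (mod N)" by (simp add: cong_iff_dvd_diff)
  have M': "int p > N + \<bar>a\<bar> + \<bar>c\<bar>" using p(2) N by (simp add: M'_def)
  have nz: "a + k * N \<noteq> 0" "c + k * N \<noteq> 0" for k
    using a c by (metis add.commute add_diff_cancel_left' diff_0 dvd_minus_iff dvd_triv_right)+
  \<comment> \<open>\<open>P\<close> is the required separation of the roots: 1 for
    \<open>Q = p\<close>, and \<open>p\<close> for \<open>Q = p\<^sup>2\<close>. Different residues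
    differ by at least 1, which separates the roots by about \<open>Q / N\<close>.\<close>
  have gap: "\<exists>ka kc. 0 \<le> ka \<and> 0 \<le> kc \<and> kc + P \<le> ka \<and> ka < Q \<and> Q dvd a + ka * N \<and> Q dvd c + kc * N"
    if g: "\<epsilon> * \<epsilon> = 1" "[Q = \<epsilon>] (mod N)" "(\<epsilon> * c) mod N < (\<epsilon> * a) mod N" "Q \<ge> P * (N + \<bar>a\<bar> + \<bar>c\<bar>)" "P \<ge> 1"
      "Q > \<bar>a\<bar> + \<bar>c\<bar>"
    for \<epsilon> Q P :: int
  proof -
    have Q: "Q > \<bar>a\<bar>" "Q > \<bar>c\<bar>" using g(6) by auto
    obtain ka where ka: "0 \<le> ka" "ka < Q" "a + ka * N = Q * ((\<epsilon> * a) mod N)"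
      using root_mod_cong_sign[OF N a g(1,2)] Q by blast
    obtain kc where kc: "0 \<le> kc" "kc < Q" "c + kc * N = Q * ((\<epsilon> * c) mod N)"
      using root_mod_cong_sign[OF N c g(1,2)] Q by blast
    have "Q * 1 \<le> Q * ((\<epsilon> * a) mod N - (\<epsilon> * c) mod N)"
      using g(3,6) by (intro mult_left_mono) auto
    then have "(ka - kc) * N \<ge> Q - a + c" using ka kc by (simp add: algebra_simps)
    moreover have "Q - a + c \<ge> P * N"
    proof -
      have "P * (\<bar>a\<bar> + \<bar>c\<bar>) \<ge> 1 * (\<bar>a\<bar> + \<bar>c\<bar>)" using g(5) by (intro mult_right_mono) auto
      then show ?thesis using g(4) by (simp add: algebra_simps)
    qed
    ultimately have "P * N \<le> (ka - kc) * N" by linarith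
    then have "kc + P \<le> ka" using N by simp
    then show ?thesis using ka kc by (metis dvd_triv_left)
  qed
  have ne: "(\<epsilon> * c) mod N \<noteq> (\<epsilon> * a) mod N" if "\<epsilon> * \<epsilon> = 1" for \<epsilon>
  proof
    assume "(\<epsilon> * c) mod N = (\<epsilon> * a) mod N"
    then have "N dvd \<epsilon> * a - \<epsilon> * c" by (metis mod_eq_dvd_iff)
    then have "N dvd \<epsilon> * (\<epsilon> * a - \<epsilon> * c)" by (rule dvd_mult)
    also have "\<epsilon> * (\<epsilon> * a - \<epsilon> * c) = (\<epsilon> * \<epsilon>) * (a - c)" by (simp add: algebra_simps)
    finally show False using ac that by simp
  qed
  show ?thesis
  proof (cases "(- 1 * c) mod N < (- 1 * a) mod N")
    case True
    then obtain ka kc where k: "0 \<le> ka" "0 \<le> kc" "kc + 1 \<le> ka" "ka < int p"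
      "int p dvd a + ka * N" "int p dvd c + kc * N"
      using gap[of "- 1" "int p" 1] pN M' N by auto
    define l where "l = nat kc"
    have l: "int l = kc" using k by (simp add: l_def)
    have "\<not> int p dvd a + int i * N" if "i < l + 1" for i
      using unique_root_mod[OF p0 cop, of "int i" a ka] k that l by auto
    then have "multiplicity (int p) (\<Prod>k<l+1. a + int k * N)
        < multiplicity (int p) (\<Prod>k<l+1. c + int k * N)"
      using k l nz by (intro multiplicity_prod_less[OF p(1), of _ _ _ l]) auto
    then show ?thesis using p by (intro exI[of _ p] exI[of _ "l + 1"]) (auto simp: M'_def)
  next
    case False
    \<comment> \<open>Negation sends a nonzero residue \<open>x\<close> to \<open>N - x\<close> and
      so reverses the order.\<close>
    then have "(1 * c) mod N < (1 * a) mod N"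
      using ne[of "- 1"] a c by (auto simp: zmod_zminus1_eq_if mod_eq_0_iff_dvd)
    moreover have "[int p * int p = - 1 * - 1] (mod N)" by (intro cong_mult pN)
    moreover have "int p * int p \<ge> int p * (N + \<bar>a\<bar> + \<bar>c\<bar>)" using M' by (intro mult_left_mono) auto
    moreover have "int p * int p > \<bar>a\<bar> + \<bar>c\<bar>"
    proof -
      have "int p * int p \<ge> 1 * int p" using p0 by (intro mult_right_mono) auto
      then show ?thesis using M' N by linarith
    qed
    ultimately obtain ka kc where k: "0 \<le> ka" "0 \<le> kc" "kc + int p \<le> ka" "ka < int p * int p"
      "int p * int p dvd a + ka * N" "int p * int p dvd c + kc * N"
      using gap[of 1 "int p * int p" "int p"] p0 by auto
    \<comment> \<open>\<open>p * m\<close> is the least multiple of \<open>p\<close> above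
      \<open>kc\<close>. By the separation it is at most \<open>ka\<close>, so the range contains
      the root for \<open>c\<close> but not the one for \<open>a\<close>.\<close>
    define m where "m = nat kc div p + 1"
    have "nat kc < p * m" using p0 by (simp add: m_def dividend_less_times_div)
    have "p * m \<le> nat kc + p" by (simp add: m_def algebra_simps)
    have cop2: "coprime (int p * int p) N" using cop by simp
    have "\<not> int p ^ 2 dvd a + int i * N" if "i < p * m" for i
    proof -
      have "i < nat kc + p" using that \<open>p * m \<le> nat kc + p\<close> by linarith
      then have "int i < ka" using k(2,3) by linarith
      then show ?thesis
        using unique_root_mod[OF _ cop2, of "int i" a ka] k p0 by (auto simp: power2_eq_square)
    qed
    then have "multiplicity (int p) (\<Prod>k<p*m. a + int k * N)
        < multiplicity (int p) (\<Prod>k<p*m. c + int k * N)"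
      using k nz \<open>nat kc < p * m\<close> \<open>\<not> int p dvd N\<close>
      by (intro multiplicity_prod_less_square[OF p(1), of _ _ _ _ "nat kc"]) (auto simp: power2_eq_square)
    moreover have "p * m \<ge> 1" using \<open>nat kc < p * m\<close> by linarith
    ultimately show ?thesis using p by (intro exI[of _ p] exI[of _ "p * m"]) (auto simp: M'_def)
  qed
qed

text \<open>Scaling numerators and denominators by \<open>N\<close> makes all factors integers and
  leaves each quotient unchanged.\<close>

lemma not_almost_integral_hypergeometric:
  fixes \<alpha> \<gamma> \<kappa> \<tau> :: rat and a c N :: int
  assumes N: "N > 0" "\<alpha> = of_int a / of_int N" "\<gamma> = of_int c / of_int N"
    and nz: "\<kappa> \<noteq> 0" "\<tau> \<noteq> 0" "\<And>k. \<alpha> + of_nat k \<noteq> 0" "\<And>k. \<gamma> + of_nat k \<noteq> 0"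
    and s: "\<And>n. s n = \<kappa> * \<tau> ^ n * (\<Prod>k<n. (\<alpha> + of_nat k) / (\<gamma> + of_nat k))"
    and bad: "\<And>M. \<exists>p n. prime p \<and> p > M \<and> n \<ge> 1 \<and> multiplicity (int p) (\<Prod>k<n. a + int k * N)
      < multiplicity (int p) (\<Prod>k<n. c + int k * N)"
  shows "\<not> almost_integral (Abs_fps s)"
proof (rule not_almost_integral[OF nz(1,2) _ _ _ bad])
  have \<alpha>: "of_int (a + int k * N) = of_int N * (\<alpha> + of_nat k)"
    and \<gamma>: "of_int (c + int k * N) = of_int N * (\<gamma> + of_nat k)" for k
    using N by (simp_all add: field_simps)
  have N0: "(of_int N :: rat) \<noteq> 0" using N(1) by simp
  show "a + int k * N \<noteq> 0" for k
    using \<alpha>[of k] nz(3)[of k] N0 by (metis mult_eq_0_iff of_int_0)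
  show "c + int k * N \<noteq> 0" for k
    using \<gamma>[of k] nz(4)[of k] N0 by (metis mult_eq_0_iff of_int_0)
  show "s n = \<kappa> * \<tau> ^ n * (\<Prod>k<n. of_int (a + int k * N) / of_int (c + int k * N))" for n
    unfolding s \<alpha> \<gamma> using N0 by simp
qed

section \<open>Algebraic and almost integral series\<close>

lemma poly_in_rational_functions: "fps_to_fls (fps_of_poly p) \<in> rational_functions"
proof -
  have "fps_to_fls (fps_of_poly p) = fps_to_fls (fps_of_poly p) / fps_to_fls (fps_of_poly 1)"
    by simp
  then show ?thesis unfolding rational_functions_def
    by (intro CollectI exI[of _ p] exI[of _ 1]) auto
qed

lemma rational_functions_add:
  assumes "f \<in> rational_functions" "g \<in> rational_functions"
  shows "f + g \<in> rational_functions"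
proof -
  obtain p q where f: "f = fps_to_fls (fps_of_poly p) / fps_to_fls (fps_of_poly q)" "q \<noteq> 0"
    using assms(1) by (auto simp: rational_functions_def)
  obtain p' q' where g: "g = fps_to_fls (fps_of_poly p') / fps_to_fls (fps_of_poly q')" "q' \<noteq> 0"
    using assms(2) by (auto simp: rational_functions_def)
  have nz: "fps_to_fls (fps_of_poly q) \<noteq> 0" "fps_to_fls (fps_of_poly q') \<noteq> 0"
    using f g by (simp_all add: fps_of_poly_eq_iff[of _ 0, simplified])
  have "f + g = fps_to_fls (fps_of_poly (p * q' + p' * q)) / fps_to_fls (fps_of_poly (q * q'))"
    using nz by (simp add: f g fps_of_poly_add fps_of_poly_mult fls_times_fps_to_fls add_frac_eq)
  moreover have "q * q' \<noteq> 0" using f g by simp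
  ultimately show ?thesis unfolding rational_functions_def by blast
qed

lemma rational_functions_mult:
  assumes "f \<in> rational_functions" "g \<in> rational_functions"
  shows "f * g \<in> rational_functions"
proof -
  obtain p q where f: "f = fps_to_fls (fps_of_poly p) / fps_to_fls (fps_of_poly q)" "q \<noteq> 0"
    using assms(1) by (auto simp: rational_functions_def)
  obtain p' q' where g: "g = fps_to_fls (fps_of_poly p') / fps_to_fls (fps_of_poly q')" "q' \<noteq> 0"
    using assms(2) by (auto simp: rational_functions_def)
  have "f * g = fps_to_fls (fps_of_poly (p * p')) / fps_to_fls (fps_of_poly (q * q'))"
    by (simp add: f g fps_of_poly_mult fls_times_fps_to_fls)
  moreover have "q * q' \<noteq> 0" using f g by simp
  ultimately show ?thesis unfolding rational_functions_def by blast
qed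

lemma rational_functions_0: "0 \<in> rational_functions"
  using poly_in_rational_functions[of 0] by simp

lemma rational_functions_1: "1 \<in> rational_functions"
  using poly_in_rational_functions[of 1] by simp

lemma rational_functions_sum:
  "(\<And>i. i \<in> A \<Longrightarrow> f i \<in> rational_functions) \<Longrightarrow> sum f A \<in> rational_functions"
  by (induction A rule: infinite_finite_induct)
    (auto simp: rational_functions_0 intro: rational_functions_add)

lemma poly_power_rational_functions:
  assumes "\<And>i. poly.coeff P i \<in> rational_functions"
  shows "poly.coeff (P ^ n) i \<in> rational_functions"
proof (induction n arbitrary: i)
  case (Suc n)
  have "poly.coeff (P * P ^ n) i \<in> rational_functions"
    unfolding coeff_mult by (intro rational_functions_sum rational_functions_mult assms Suc.IH)
  then show ?case by simp
qed (auto simp: coeff_1 rational_functions_0 rational_functions_1)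

text \<open>\<open>f\<close> is a root of \<open>D (A + B X) ^ q - E\<close>, whose coefficient
  \<open>D B ^ q\<close> of \<open>X ^ q\<close> is nonzero. The shape covers rational series
  (\<open>q = 1\<close>) and tails of a root of a rational function.\<close>

lemma algebraic_fpsI:
  fixes A B D E :: "rat poly" and f :: "rat fps"
  assumes nz: "B \<noteq> 0" "D \<noteq> 0" "q > 0"
    and eq: "fps_of_poly D * (fps_of_poly A + fps_of_poly B * f) ^ q = fps_of_poly E"
  shows "algebraic_fps f"
proof -
  define \<phi> where "\<phi> p = fps_to_fls (fps_of_poly p)" for p :: "rat poly"
  have \<phi>0: "\<phi> p = 0 \<longleftrightarrow> p = 0" for p
    by (simp add: \<phi>_def fps_of_poly_eq_iff[of _ 0, simplified])
  define P where "P = [:\<phi> D:] * [:\<phi> A, \<phi> B:] ^ q + [:\<phi> (- E):]"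
  have "degree ([:\<phi> A, \<phi> B:] ^ q) = q" using nz by (simp add: degree_power_eq \<phi>0)
  then have "poly.coeff ([:\<phi> A, \<phi> B:] ^ q) q = \<phi> B ^ q"
    using lead_coeff_power[of "[:\<phi> A, \<phi> B:]" q] nz by (simp add: \<phi>0)
  then have "poly.coeff P q \<noteq> 0"
    using nz by (auto simp: P_def \<phi>0 coeff_pCons split: nat.splits)
  then have "P \<noteq> 0" by auto
  moreover have "poly.coeff P i \<in> rational_functions" for i
  proof -
    have \<phi>: "\<phi> p \<in> rational_functions" for p
      by (simp add: \<phi>_def poly_in_rational_functions)
    have "poly.coeff [:\<phi> A, \<phi> B:] j \<in> rational_functions" "poly.coeff [:\<phi> (- E):] j \<in> rational_functions" for j
      by (auto simp: coeff_pCons \<phi> rational_functions_0 split: nat.splits)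
    then have "\<phi> D * poly.coeff ([:\<phi> A, \<phi> B:] ^ q) i + poly.coeff [:\<phi> (- E):] i \<in> rational_functions"
      by (intro rational_functions_add rational_functions_mult \<phi> poly_power_rational_functions)
    then show ?thesis by (simp add: P_def)
  qed
  moreover have "poly P (fps_to_fls f) = 0"
  proof -
    have "poly P (fps_to_fls f) = \<phi> D * (\<phi> A + fps_to_fls f * \<phi> B) ^ q + \<phi> (- E)"
      by (simp add: P_def)
    also have "\<dots> = fps_to_fls (fps_of_poly D * (fps_of_poly A + f * fps_of_poly B) ^ q
        + fps_of_poly (- E))"
      by (simp only: \<phi>_def fls_times_fps_to_fls fps_to_fls_power fps_to_fls_plus)
    also have "fps_of_poly D * (fps_of_poly A + f * fps_of_poly B) ^ q = fps_of_poly E"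
      using eq by (simp only: mult.commute)
    finally show ?thesis by (simp add: fps_of_poly_uminus)
  qed
  ultimately show ?thesis unfolding algebraic_fps_def by blast
qed

lemma algebraic_fps_rational:
  fixes B E :: "rat poly"
  assumes "B \<noteq> 0" "fps_of_poly B * f = fps_of_poly E"
  shows "algebraic_fps f"
  by (rule algebraic_fpsI[of B 1 1 0 _ E]) (use assms in auto)

section \<open>Clearing denominators; polynomials times geometric sequences\<close>

text \<open>Only \<open>n \<ge> 1\<close> is tested, so a fixed denominator \<open>K\<close> is
  absorbed by \<open>K ^ n\<close>.\<close>

lemma almost_integralI:
  fixes K C :: int
  assumes nz: "K \<noteq> 0" "C \<noteq> 0" and s: "\<And>n. of_int K * of_int C ^ n * s n \<in> \<int>"
  shows "almost_integral (Abs_fps s)"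
  unfolding almost_integral_def
proof (intro exI[of _ "K * C"] conjI allI impI)
  fix n :: nat assume n: "n \<ge> 1"
  have "of_int (K * C) ^ n * s n = of_int K ^ (n - 1) * (of_int K * of_int C ^ n * s n)"
    using n by (cases n) (simp_all add: power_mult_distrib)
  also have "\<dots> \<in> \<int>" by (rule Ints_mult[OF Ints_power[OF Ints_of_int] s])
  finally show "of_int (K * C) ^ n * fps_nth (Abs_fps s) n \<in> \<int>" by simp
qed (use nz in auto)

lemma rat_common_denominator:
  obtains d :: int where "d > 0" "of_int d * (x :: rat) \<in> \<int>"
proof -
  obtain a b where "x = of_int a / of_int b" "b > 0"
    using quotient_of_div surj_pair quotient_of_denom_pos by metis
  then show thesis using that[of b] by simp
qed

lemma poly_common_denominator:
  fixes R :: "rat poly"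
  shows "\<exists>K::int. K > 0 \<and> (\<forall>n. of_int K * poly R (of_nat n) \<in> \<int>)"
proof (induction R)
  case 0
  show ?case by (intro exI[of _ 1]) simp
next
  case (pCons r R)
  then obtain K :: int where K: "K > 0" "\<And>n. of_int K * poly R (of_nat n) \<in> \<int>" by blast
  obtain d where d: "d > 0" "of_int d * r \<in> \<int>" using rat_common_denominator by blast
  have "of_int (d * K) * poly (pCons r R) (of_nat n) \<in> \<int>" for n
  proof -
    have "of_int (d * K) * poly (pCons r R) (of_nat n)
        = of_int K * (of_int d * r) + of_int d * of_nat n * (of_int K * poly R (of_nat n))"
      by (simp add: algebra_simps)
    also have "\<dots> \<in> \<int>"
      using K(2)[of n] d(2) by (intro Ints_add[OF Ints_mult Ints_mult[OF Ints_mult]]) auto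
    finally show ?thesis .
  qed
  then show ?case using K d by (intro exI[of _ "d * K"]) simp
qed

lemma poly_times_power_almost_integral:
  "almost_integral (Abs_fps (\<lambda>n. poly R (of_nat n) * \<tau> ^ n))"
proof -
  obtain K :: int where K: "K > 0" "\<And>n. of_int K * poly R (of_nat n) \<in> \<int>"
    using poly_common_denominator by blast
  obtain d where d: "d > 0" "of_int d * \<tau> \<in> \<int>" using rat_common_denominator by blast
  have "of_int K * of_int d ^ n * (poly R (of_nat n) * \<tau> ^ n) \<in> \<int>" for n
  proof -
    have "of_int K * of_int d ^ n * (poly R (of_nat n) * \<tau> ^ n)
        = (of_int K * poly R (of_nat n)) * (of_int d * \<tau>) ^ n"
      by (simp add: power_mult_distrib)
    also have "\<dots> \<in> \<int>" using K(2) d(2) by (rule Ints_mult[OF _ Ints_power])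
    finally show ?thesis .
  qed
  then show ?thesis using K d by (intro almost_integralI[of K d]) auto
qed

text \<open>Horner induction: multiplying the coefficients by \<open>n\<close> is the operator
  \<open>x d/dx\<close>, which preserves rational functions, and the constant \<open>r\<close> adds
  a geometric series.\<close>

lemma poly_times_power_rational:
  fixes R :: "rat poly"
  shows "\<exists>B E. B \<noteq> 0 \<and> fps_of_poly B * Abs_fps (\<lambda>n. poly R (of_nat n) * \<tau> ^ n) = fps_of_poly E"
proof (induction R)
  case 0
  show ?case by (intro exI[of _ 1] exI[of _ 0]) (simp add: fps_eq_iff)
next
  case (pCons r R)
  define T where "T = Abs_fps (\<lambda>n. poly R (of_nat n) * \<tau> ^ n)"
  define G where "G = Abs_fps (\<lambda>n. \<tau> ^ n)"
  define L where "L = [:1, - \<tau>:]"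
  obtain B E where B: "B \<noteq> 0" "fps_of_poly B * T = fps_of_poly E" using pCons T_def by blast
  have "fps_of_poly L = 1 - fps_const \<tau> * fps_X"
    by (simp add: L_def fps_of_poly_linear' flip: fps_const_neg)
  then have "fps_of_poly L * G = G - fps_const \<tau> * (fps_X * G)"
    by (simp only: left_diff_distrib mult_1_left mult.assoc)
  also have "\<dots> = 1"
  proof (rule fps_ext)
    fix n
    show "fps_nth (G - fps_const \<tau> * (fps_X * G)) n = fps_nth 1 n"
      by (cases n) (simp_all add: G_def)
  qed
  finally have LG: "fps_of_poly L * G = 1" .
  have S: "Abs_fps (\<lambda>n. poly (pCons r R) (of_nat n) * \<tau> ^ n) = fps_const r * G + fps_X * fps_deriv T"
    (is "?S = _")
  proof (rule fps_ext)
    fix n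
    show "fps_nth ?S n = fps_nth (fps_const r * G + fps_X * fps_deriv T) n"
      by (cases n) (simp_all add: G_def T_def algebra_simps)
  qed
  have "fps_deriv (fps_of_poly B * T) = fps_of_poly (pderiv E)"
    by (simp add: B(2) fps_of_poly_pderiv)
  then have T': "fps_of_poly B * fps_deriv T = fps_of_poly (pderiv E) - fps_of_poly (pderiv B) * T"
    by (simp add: fps_of_poly_pderiv algebra_simps)
  \<comment> \<open>The quotient rule for \<open>T = E / B\<close>, with denominators
    cleared.\<close>
  have "fps_of_poly B * (fps_of_poly B * fps_deriv T)
      = fps_of_poly B * fps_of_poly (pderiv E) - fps_of_poly (pderiv B) * (fps_of_poly B * T)"
    unfolding T' by (simp add: algebra_simps)
  then have BB: "fps_of_poly B * (fps_of_poly B * fps_deriv T) = fps_of_poly (B * pderiv E - pderiv B * E)"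
    by (simp add: B(2) fps_of_poly_mult fps_of_poly_diff)
  have "fps_of_poly (B * B * L) * ?S
      = fps_const r * (fps_of_poly B * fps_of_poly B) * (fps_of_poly L * G)
        + fps_X * fps_of_poly L * (fps_of_poly B * (fps_of_poly B * fps_deriv T))"
    unfolding S by (simp add: fps_of_poly_mult algebra_simps)
  also have "\<dots> = fps_of_poly ([:r:] * (B * B) + [:0, 1:] * L * (B * pderiv E - pderiv B * E))"
    unfolding LG BB by (simp only: fps_of_poly_mult fps_of_poly_add fps_of_poly_const fps_of_poly_fps_X mult_1_right)
  finally have "fps_of_poly (B * B * L) * ?S
      = fps_of_poly ([:r:] * (B * B) + [:0, 1:] * L * (B * pderiv E - pderiv B * E))" .
  moreover have "L \<noteq> 0" by (simp add: L_def)
  then have "B * B * L \<noteq> 0" using B(1) by simp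
  ultimately show ?case by blast
qed

section \<open>Factorials dividing products over arithmetic progressions\<close>

text \<open>Legendre's formula in recursive form: the multiples of \<open>l\<close> up to
  \<open>m\<close> contribute one factor \<open>l\<close> each and leave
  \<open>fact (m div l)\<close>.\<close>

lemma multiplicity_fact_div:
  fixes l :: nat
  assumes l: "prime l"
  shows "multiplicity (int l) (fact m) = multiplicity (int l) (fact (m div l)) + m div l"
proof (induction m)
  case (Suc m)
  have l0: "l > 0" using l prime_gt_0_nat by blast
  have v: "multiplicity (int l) (fact (Suc k))
      = multiplicity (int l) (int (Suc k)) + multiplicity (int l) (fact k)" for k
    unfolding fact_Suc using l by (subst prime_elem_multiplicity_mult_distrib) auto
  show ?case
  proof (cases "l dvd Suc m")
    case False
    then have 1: "Suc m div l = m div l" by (simp add: div_Suc dvd_eq_mod_eq_0)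
    have "\<not> int l dvd int (Suc m)" using False int_dvd_int_iff[of l "Suc m"] by blast
    then have "multiplicity (int l) (int (Suc m)) = 0" by (rule not_dvd_imp_multiplicity_0)
    then show ?thesis using Suc.IH v[of m] unfolding 1 by linarith
  next
    case True
    then obtain j where j: "Suc m = l * j" by (elim dvdE)
    then obtain i where i: "j = Suc i" by (cases j) auto
    have 1: "Suc m div l = Suc i" using j i l0 by simp
    have 2: "m div l = i"
      using True 1 by (simp add: div_Suc dvd_eq_mod_eq_0)
    have "multiplicity (int l) (int l * int (Suc i)) = Suc (multiplicity (int l) (int (Suc i)))"
      using l by (intro multiplicity_times_same) (auto simp: not_prime_unit)
    then have 3: "multiplicity (int l) (int (Suc m)) = Suc (multiplicity (int l) (int (Suc i)))"
      unfolding j i by (simp only: of_nat_mult)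
    show ?thesis using Suc.IH v[of m] v[of i] 3 unfolding 1 2 by linarith
  qed
qed simp

lemma multiplicity_fact_le:
  fixes l :: nat
  assumes l: "prime l"
  shows "multiplicity (int l) (fact m) \<le> m"
proof (induction m rule: less_induct)
  case (less m)
  show ?case
  proof (cases "m = 0")
    case False
    have l2: "l \<ge> 2" using l prime_ge_2_nat by blast
    then have "m div l < m" using False by simp
    then have "multiplicity (int l) (fact (m div l)) \<le> m div l" by (rule less.IH)
    then have "multiplicity (int l) (fact m) \<le> 2 * (m div l)"
      using multiplicity_fact_div[OF l, of m] by linarith
    also have "\<dots> \<le> l * (m div l)" using l2 by (intro mult_right_mono) auto
    also have "\<dots> \<le> m" by simp
    finally show ?thesis .
  qed simp
qed

text \<open>For a positive start this is the integrality of binomial coefficients.\<close>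

lemma fact_dvd_prod_consecutive:
  fixes x :: int
  shows "fact m dvd (\<Prod>i<m. x + int i)"
proof -
  have nat: "(fact m :: nat) dvd (\<Prod>i<m. Suc y + i)" for y
  proof -
    have "fact y * (\<Prod>i<m. Suc y + i) = (fact (y + m) :: nat)"
      by (induction m) (simp_all add: algebra_simps)
    then have "fact y * fact m dvd fact y * (\<Prod>i<m. Suc y + i)"
      by (metis fact_fact_dvd_fact)
    then show ?thesis by (simp del: prod.lessThan_Suc)
  qed
  \<comment> \<open>Adding multiples of \<open>fact m\<close> changes nothing modulo
    \<open>fact m\<close> and moves the start to a positive integer.\<close>
  define y where "y = nat (x + \<bar>x\<bar> * fact m)"
  have "\<bar>x\<bar> * 1 \<le> \<bar>x\<bar> * (fact m :: int)" by (intro mult_left_mono fact_ge_1) auto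
  then have y: "int y = x + \<bar>x\<bar> * fact m" unfolding y_def by simp
  have "int (fact m) dvd int (\<Prod>i<m. Suc (y + fact m - 1) + i)"
    using nat by (simp only: int_dvd_int_iff)
  moreover have "Suc (y + fact m - 1) = y + fact m" by simp
  ultimately have "(fact m :: int) dvd (\<Prod>i<m. int y + fact m + int i)" by simp
  moreover have "[(\<Prod>i<m. int y + fact m + int i) = (\<Prod>i<m. x + int i)] (mod fact m)"
    by (intro cong_prod cong_add cong_refl) (simp add: y cong_iff_dvd_diff)
  ultimately show ?thesis using cong_dvd_iff by blast
qed

text \<open>Prime by prime: if \<open>l\<close> divides \<open>q\<close>, then \<open>q ^ m\<close>
  alone suffices, as \<open>l\<close> occurs at most \<open>m\<close> times in
  \<open>fact m\<close>. Otherwise \<open>q\<close> is invertible modulo \<open>l ^ e\<close>, and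
  up to a unit the progression becomes consecutive integers.\<close>

lemma fact_dvd_power_times_prod:
  fixes p q :: int
  assumes q: "q \<noteq> 0"
  shows "fact m dvd q ^ m * (\<Prod>i<m. p + int i * q)"
proof (cases "q ^ m * (\<Prod>i<m. p + int i * q) = 0")
  case nz: False
  show ?thesis
  proof (rule multiplicity_le_imp_dvd)
    fix l :: int assume l: "prime l"
    obtain l' where l'_eq: "l = int l'" using l prime_ge_0_int zero_le_imp_eq_int by blast
    with l have l': "prime l'" by simp
    define e where "e = multiplicity l (fact m)"
    have le: "l ^ e dvd fact m" unfolding e_def by (rule multiplicity_dvd)
    have "l ^ e dvd q ^ m * (\<Prod>i<m. p + int i * q)"
    proof (cases "l dvd q")
      case True
      have "e \<le> m" unfolding e_def l'_eq by (rule multiplicity_fact_le[OF l'])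
      then have "l ^ e dvd l ^ m" by (rule le_imp_power_dvd)
      also have "\<dots> dvd q ^ m" using True by (rule dvd_power_same)
      finally have "l ^ e dvd q ^ m" .
      then show ?thesis by simp
    next
      case False
      obtain r where r: "[q * r = 1] (mod l ^ e)"
        using cong_solve_coprime_int[of q "l ^ e"] False l by (auto simp: coprime_commute prime_imp_coprime)
      have "l ^ e dvd (\<Prod>i<m. p * r + int i)"
        using le fact_dvd_prod_consecutive dvd_trans by blast
      moreover have "[q ^ m * (\<Prod>i<m. p * r + int i) = (\<Prod>i<m. p + int i * q)] (mod l ^ e)"
      proof -
        have "q ^ m * (\<Prod>i<m. p * r + int i) = (\<Prod>i<m. p * (q * r) + int i * q)"
          by (induction m) (simp_all add: algebra_simps)
        also have "[\<dots> = (\<Prod>i<m. p * 1 + int i * q)] (mod l ^ e)"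
          by (intro cong_prod cong_add cong_mult r cong_refl)
        finally show ?thesis by simp
      qed
      ultimately have "l ^ e dvd (\<Prod>i<m. p + int i * q)"
        using cong_dvd_iff dvd_mult by blast
      then show ?thesis by simp
    qed
    then show "multiplicity l (fact m) \<le> multiplicity l (q ^ m * (\<Prod>i<m. p + int i * q))"
      using nz l not_prime_unit unfolding e_def[symmetric] by (intro multiplicity_geI) auto
  qed (use nz in auto)
next
  case True
  then show ?thesis by (simp only: dvd_0_right)
qed

section \<open>The binomial series with rational exponent\<close>

text \<open>\<open>F\<close> is the expansion of \<open>(1 - \<tau> x)\<close> to the power
  \<open>- \<delta>\<close>. For \<open>\<delta> = p / q\<close> its \<open>q\<close>-th power is a
  power of \<open>1 - \<tau> x\<close> with integer exponent \<open>- p\<close>, whose sign decides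
  between polynomial and reciprocal.\<close>

lemma binomial_series_algebraic:
  fixes \<delta> \<tau> :: rat
  defines "F \<equiv> Abs_fps (\<lambda>m. pochhammer \<delta> m / fact m * \<tau> ^ m)"
  shows "\<exists>D E q. D \<noteq> 0 \<and> q > 0 \<and> fps_of_poly D * F ^ q = fps_of_poly E"
proof -
  define x where "x = fps_const (- \<tau>) * fps_X"
  have x0: "fps_nth x 0 = 0" by (simp add: x_def)
  have F: "F = fps_binomial (- \<delta>) oo x"
  proof (rule fps_ext)
    fix m
    have "(- \<tau>) ^ m * ((- \<delta>) gchoose m) = ((- 1) ^ m * (- 1) ^ m) * (pochhammer \<delta> m / fact m * \<tau> ^ m)"
      by (simp add: gbinomial_pochhammer power_minus[of \<tau>])
    then show "fps_nth F m = fps_nth (fps_binomial (- \<delta>) oo x) m"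
      by (simp add: F_def x_def fps_compose_linear flip: power_mult_distrib)
  qed
  define L where "L = [:1, - \<tau>:]"
  have L: "(1 + fps_X) oo x = fps_of_poly L"
    by (simp add: L_def x_def fps_compose_add_distrib fps_of_poly_linear')
  obtain p q where pq: "\<delta> = of_int p / of_int q" "q > 0"
    using quotient_of_div surj_pair quotient_of_denom_pos by metis
  have "F ^ nat q = (fps_binomial (- \<delta>) ^ nat q) oo x"
    unfolding F by (simp add: fps_compose_power[OF x0])
  also have "fps_binomial (- \<delta>) ^ nat q = fps_binomial (of_int (- p))"
    using pq by (simp add: fps_binomial_power)
  finally have Fq: "F ^ nat q = fps_binomial (of_int (- p)) oo x" .
  show ?thesis
  proof (cases "p \<le> 0")
    case True
    then have "of_int (- p) = (of_nat (nat (- p)) :: rat)" by simp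
    then have "F ^ nat q = fps_of_poly (L ^ nat (- p))"
      unfolding Fq by (simp only: fps_binomial_of_nat fps_compose_power[OF x0, symmetric] L fps_of_poly_power)
    then show ?thesis using pq(2) by (intro exI[of _ 1] exI[of _ "L ^ nat (- p)"] exI[of _ "nat q"]) simp
  next
    case False
    then have p: "of_int p = (of_nat (nat p) :: rat)" by simp
    have "fps_binomial (of_int p) * fps_binomial (of_int (- p)) = (1 :: rat fps)"
      by (simp flip: fps_binomial_add_mult)
    then have "(fps_binomial (of_int p) oo x) * F ^ nat q = 1"
      unfolding Fq by (simp flip: fps_compose_mult_distrib[OF x0])
    moreover have "fps_binomial (of_int p) oo x = fps_of_poly (L ^ nat p)"
      unfolding p by (simp only: fps_binomial_of_nat fps_compose_power[OF x0, symmetric] L fps_of_poly_power)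
    ultimately have "fps_of_poly (L ^ nat p) * F ^ nat q = fps_of_poly 1" by simp
    moreover have "L ^ nat p \<noteq> 0" by (simp add: L_def)
    ultimately show ?thesis using pq(2) by (metis zero_less_nat_eq)
  qed
qed

text \<open>\<open>C = q\<^sup>2\<close> for the denominator \<open>q\<close> of
  \<open>\<delta>\<close>: one \<open>q ^ n\<close> makes the Pochhammer symbol integral, the other
  makes it divisible by \<open>fact n\<close>.\<close>

lemma binomial_coefficients_integral:
  fixes \<delta> :: rat
  obtains C :: int where "C > 0" "\<And>n. of_int C ^ n * (pochhammer \<delta> n / fact n) \<in> \<int>"
proof -
  obtain p q where pq: "\<delta> = of_int p / of_int q" "q > 0"
    using quotient_of_div surj_pair quotient_of_denom_pos by metis
  have "of_int (q * q) ^ n * (pochhammer \<delta> n / fact n) \<in> \<int>" for n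
  proof -
    have "of_int q ^ n * pochhammer \<delta> n = (\<Prod>i<n. of_int (p + int i * q))"
      using pq(2) by (induction n) (simp_all add: pochhammer_Suc pq(1) field_simps)
    then have *: "of_int q ^ n * (of_int q ^ n * pochhammer \<delta> n) = of_int (q ^ n * (\<Prod>i<n. p + int i * q))"
      by simp
    obtain z where z: "q ^ n * (\<Prod>i<n. p + int i * q) = fact n * z"
      using fact_dvd_power_times_prod[of q n p] pq(2) by (auto elim: dvdE)
    have "of_int (q * q) ^ n * (pochhammer \<delta> n / fact n)
        = of_int q ^ n * (of_int q ^ n * pochhammer \<delta> n) / fact n"
      by (simp add: power_mult_distrib)
    also have "\<dots> = of_int z" unfolding * z by simp
    finally show ?thesis by simp
  qed
  then show thesis using that[of "q * q"] pq(2) by simp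
qed

text \<open>Multiplied by \<open>x ^ h / \<kappa>\<close>, the series is the binomial series without
  its first \<open>h\<close> terms.\<close>

lemma binomial_shift_algebraic:
  fixes \<delta> \<tau> \<kappa> :: rat
  assumes \<kappa>: "\<kappa> \<noteq> 0" and s: "\<And>n. s n = \<kappa> * (pochhammer \<delta> (n + h) / fact (n + h) * \<tau> ^ (n + h))"
  shows "algebraic_fps (Abs_fps s)"
proof -
  define F where "F = Abs_fps (\<lambda>m. pochhammer \<delta> m / fact m * \<tau> ^ m)"
  obtain D E q where D: "D \<noteq> 0" "q > 0" "fps_of_poly D * F ^ q = fps_of_poly E"
    using binomial_series_algebraic unfolding F_def by blast
  have "F = fps_of_poly (truncate_fps h F) + fps_of_poly (Polynomial.monom (1 / \<kappa>) h) * Abs_fps s"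
  proof (rule fps_ext)
    fix n
    show "fps_nth F n = fps_nth (fps_of_poly (truncate_fps h F) + fps_of_poly (Polynomial.monom (1 / \<kappa>) h) * Abs_fps s) n"
      using \<kappa> by (simp add: fps_of_poly_monom mult.assoc fps_X_power_mult_nth F_def s)
  qed
  with D(3) have "fps_of_poly D * (fps_of_poly (truncate_fps h F)
      + fps_of_poly (Polynomial.monom (1 / \<kappa>) h) * Abs_fps s) ^ q = fps_of_poly E" by simp
  then show ?thesis
    using D \<kappa> by (intro algebraic_fpsI[of "Polynomial.monom (1 / \<kappa>) h" D q "truncate_fps h F" _ E]) auto
qed

lemma binomial_shift_almost_integral:
  fixes \<delta> \<tau> \<kappa> :: rat
  assumes s: "\<And>n. s n = \<kappa> * (pochhammer \<delta> (n + h) / fact (n + h) * \<tau> ^ (n + h))"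
  shows "almost_integral (Abs_fps s)"
proof -
  obtain C :: int where C: "C > 0" "\<And>n. of_int C ^ n * (pochhammer \<delta> n / fact n) \<in> \<int>"
    using binomial_coefficients_integral by blast
  obtain d where d: "d > 0" "of_int d * \<tau> \<in> \<int>" using rat_common_denominator by blast
  obtain e where e: "e > 0" "of_int e * \<kappa> \<in> \<int>" using rat_common_denominator by blast
  \<comment> \<open>\<open>(C * d) ^ h\<close> pays for the shift of the index, \<open>e\<close> for
    \<open>\<kappa>\<close>.\<close>
  have "of_int (e * (C * d) ^ h) * of_int (C * d) ^ n * s n \<in> \<int>" for n
  proof -
    have "of_int (e * (C * d) ^ h) * of_int (C * d) ^ n * s n = (of_int e * \<kappa>)
        * ((of_int C ^ (n + h) * (pochhammer \<delta> (n + h) / fact (n + h))) * (of_int d * \<tau>) ^ (n + h))"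
      by (simp add: s power_mult_distrib power_add)
    also have "\<dots> \<in> \<int>" by (rule Ints_mult[OF e(2) Ints_mult[OF C(2) Ints_power[OF d(2)]]])
    finally show ?thesis .
  qed
  then show ?thesis using C d e by (intro almost_integralI[of "e * (C * d) ^ h" "C * d"]) auto
qed

section \<open>Terminating series and radius of convergence\<close>

lemma finite_support_almost_integral:
  assumes s: "\<And>n. n \<ge> M \<Longrightarrow> s n = 0"
  shows "almost_integral (Abs_fps s)"
proof -
  have "\<exists>K::int. K > 0 \<and> (\<forall>n<M. of_int K * s n \<in> \<int>)"
  proof (induction M)
    case 0
    show ?case by (intro exI[of _ 1]) simp
  next
    case (Suc M)
    then obtain K :: int where K: "K > 0" "\<And>n. n < M \<Longrightarrow> of_int K * s n \<in> \<int>" by blast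
    obtain d where d: "d > 0" "of_int d * s M \<in> \<int>" using rat_common_denominator by blast
    have "of_int (K * d) * s n \<in> \<int>" if "n < Suc M" for n
    proof (cases "n = M")
      case True
      have "of_int (K * d) * s n = of_int K * (of_int d * s M)" by (simp add: True)
      also have "\<dots> \<in> \<int>" by (rule Ints_mult[OF Ints_of_int d(2)])
      finally show ?thesis .
    next
      case False
      then have n: "n < M" using that by simp
      have "of_int (K * d) * s n = of_int d * (of_int K * s n)" by simp
      also have "\<dots> \<in> \<int>" by (rule Ints_mult[OF Ints_of_int K(2)[OF n]])
      finally show ?thesis .
    qed
    then show ?case using K d by (intro exI[of _ "K * d"]) simp
  qed
  then obtain K :: int where K: "K > 0" "\<And>n. n < M \<Longrightarrow> of_int K * s n \<in> \<int>" by blast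
  have "of_int K * of_int 1 ^ n * s n \<in> \<int>" for n
    using K(2)[of n] s[of n] by (cases "n < M") simp_all
  then show ?thesis using K by (intro almost_integralI[of K 1]) auto
qed

lemma finite_support_algebraic:
  assumes s: "\<And>n. n \<ge> M \<Longrightarrow> s n = 0"
  shows "algebraic_fps (Abs_fps s)"
proof (rule algebraic_fps_rational)
  show "fps_of_poly 1 * Abs_fps s = fps_of_poly (truncate_fps M (Abs_fps s))"
    by (rule fps_ext) (simp add: s)
qed simp

lemma norm_of_rat_complex: "norm (of_rat x :: complex) = of_rat \<bar>x\<bar>"
proof -
  have "(of_rat x :: complex) = of_real (of_rat x)"
    by (induction x) (simp add: of_rat_rat)
  then show ?thesis by (simp add: abs_if of_rat_less_0_iff of_rat_minus)
qed

text \<open>Terms grow at most like \<open>L ^ n\<close> with \<open>L = max K 1\<close>, so at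
  \<open>1 / (2 L)\<close> the series is dominated by a geometric one of ratio 1/2.\<close>

lemma conv_radius_pos_of_ratio_bound:
  fixes s :: "nat \<Rightarrow> rat"
  assumes K: "\<And>n. \<bar>s (Suc n)\<bar> \<le> K * \<bar>s n\<bar>"
  shows "fps_conv_radius (Abs_fps (\<lambda>n. of_rat (fps_nth (Abs_fps s) n) :: complex)) > 0"
proof -
  define L where "L = max K 1"
  have L: "L \<ge> 1" "K \<le> L" by (simp_all add: L_def)
  have "\<bar>s n\<bar> \<le> L ^ n * \<bar>s 0\<bar>" for n
  proof (induction n)
    case (Suc n)
    have "\<bar>s (Suc n)\<bar> \<le> K * \<bar>s n\<bar>" by (rule K)
    also have "\<dots> \<le> L * \<bar>s n\<bar>" using L by (intro mult_right_mono) auto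
    also have "\<dots> \<le> L * (L ^ n * \<bar>s 0\<bar>)" using Suc L by (intro mult_left_mono) auto
    finally show ?case by simp
  qed simp
  then have "(of_rat \<bar>s n\<bar> :: real) \<le> of_rat (L ^ n * \<bar>s 0\<bar>)" for n
    by (simp only: of_rat_less_eq)
  then have bound: "norm (of_rat (s n) :: complex) \<le> of_rat L ^ n * of_rat \<bar>s 0\<bar>" for n
    by (simp add: norm_of_rat_complex of_rat_mult of_rat_power)
  have L1: "(of_rat L :: real) \<ge> 1" using L(1) by simp
  define z :: complex where "z = of_real (1 / (2 * of_rat L))"
  have nz: "norm z = 1 / (2 * of_rat L)" using L1 by (simp add: z_def norm_divide)
  have "summable (\<lambda>n. of_rat (s n) * z ^ n)"
  proof (rule summable_comparison_test')
    show "summable (\<lambda>n. of_rat \<bar>s 0\<bar> * (1 / 2 :: real) ^ n)"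
      by (intro summable_mult summable_geometric) simp
    fix n :: nat assume "n \<ge> 0"
    have "norm (of_rat (s n) * z ^ n) = norm (of_rat (s n) :: complex) * (1 / (2 * of_rat L)) ^ n"
      by (simp add: norm_mult norm_power nz)
    also have "\<dots> \<le> (of_rat L ^ n * of_rat \<bar>s 0\<bar>) * (1 / (2 * of_rat L)) ^ n"
      using L1 by (intro mult_right_mono bound) auto
    also have "\<dots> = of_rat \<bar>s 0\<bar> * (1 / 2) ^ n"
      using L1 by (simp add: power_divide power_mult_distrib)
    finally show "norm (of_rat (s n) * z ^ n) \<le> of_rat \<bar>s 0\<bar> * (1 / 2) ^ n" .
  qed
  then have "conv_radius (\<lambda>n. of_rat (s n) :: complex) \<ge> norm z" by (rule conv_radius_geI)
  moreover have "norm z > 0" using L1 nz by simp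
  ultimately show ?thesis unfolding fps_conv_radius_def
    by (simp add: less_le_trans[of 0 "ereal (norm z)"])
qed

text \<open>If \<open>b\<close> has denominator \<open>d\<close>, then \<open>\<bar>n + b\<bar> \<ge> 1 / d\<close> unless it vanishes.\<close>
lemma shifted_quotient_bounded:
  fixes \<beta> b :: rat
  assumes nz: "\<And>k. b + 1 + of_nat k \<noteq> 0"
  obtains K where "\<And>k. \<bar>(\<beta> + 1 + of_nat k) / (b + 1 + of_nat k)\<bar> \<le> K"
proof -
  obtain d where d: "d > 0" "of_int d * b \<in> \<int>" using rat_common_denominator by blast
  have "\<bar>(\<beta> + 1 + of_nat k) / (b + 1 + of_nat k)\<bar> \<le> 1 + \<bar>\<beta> - b\<bar> * of_int d" for k
  proof -
    obtain z where z: "of_int d * (b + 1 + of_nat k) = of_int z"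
    proof -
      have "of_int d * (b + 1 + of_nat k) = of_int d * b + of_int (d * (1 + int k))"
        by (simp add: algebra_simps)
      then have "of_int d * (b + 1 + of_nat k) \<in> \<int>" using d(2) by simp
      then show thesis using that by (auto elim: Ints_cases)
    qed
    have "z \<noteq> 0" using z nz[of k] d(1) by auto
    then have "(1 :: rat) \<le> of_int \<bar>z\<bar>" by simp
    also have "\<dots> = of_int d * \<bar>b + 1 + of_nat k\<bar>"
      using d(1) by (simp add: abs_mult flip: z)
    finally have 1: "1 / \<bar>b + 1 + of_nat k\<bar> \<le> of_int d"
      using nz[of k] by (simp add: field_simps)
    have "(\<beta> + 1 + of_nat k) / (b + 1 + of_nat k) = 1 + (\<beta> - b) / (b + 1 + of_nat k)"
      using nz[of k] by (simp add: field_simps)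
    also have "\<bar>\<dots>\<bar> \<le> \<bar>1\<bar> + \<bar>(\<beta> - b) / (b + 1 + of_nat k)\<bar>" by (rule abs_triangle_ineq)
    also have "\<dots> = 1 + \<bar>\<beta> - b\<bar> * (1 / \<bar>b + 1 + of_nat k\<bar>)" by simp
    also have "\<dots> \<le> 1 + \<bar>\<beta> - b\<bar> * of_int d" using 1 by (intro add_mono mult_left_mono) auto
    finally show ?thesis .
  qed
  then show thesis by (rule that)
qed

section \<open>Quotients of Pochhammer symbols\<close>

lemma pochhammer_quotient:
  "(\<Prod>k<n. (\<alpha> + of_nat k) / (\<gamma> + of_nat k)) = pochhammer \<alpha> n / (pochhammer \<gamma> n :: rat)"
  by (simp add: pochhammer_prod prod_dividef lessThan_atLeast0)

text \<open>Splitting the symbol of length \<open>n + m\<close> at \<open>\<gamma>\<close> in two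
  ways exchanges \<open>n\<close> and \<open>m\<close>, which leaves \<open>m\<close> factors linear
  in \<open>n\<close> over a constant.\<close>

lemma pochhammer_quotient_poly:
  fixes \<gamma> :: rat
  assumes nz: "\<And>k. \<gamma> + of_nat k \<noteq> 0"
  obtains R where "\<And>n. pochhammer (\<gamma> + of_nat m) n / pochhammer \<gamma> n = poly R (of_nat n)"
proof -
  have pnz: "pochhammer \<gamma> n \<noteq> 0" for n
    using nz by (auto simp: pochhammer_eq_0_iff add_eq_0_iff2)
  define R where "R = [:1 / pochhammer \<gamma> m:] * (\<Prod>i<m. [:\<gamma> + of_nat i, 1:])"
  have "pochhammer (\<gamma> + of_nat m) n / pochhammer \<gamma> n = poly R (of_nat n)" for n
  proof -
    have "pochhammer \<gamma> m * pochhammer (\<gamma> + of_nat m) n = pochhammer \<gamma> n * pochhammer (\<gamma> + of_nat n) m"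
      by (simp only: pochhammer_product'[symmetric] add.commute)
    then have "pochhammer (\<gamma> + of_nat m) n / pochhammer \<gamma> n = pochhammer (\<gamma> + of_nat n) m / pochhammer \<gamma> m"
      using pnz by (simp add: field_simps)
    also have "\<dots> = poly R (of_nat n)"
      by (simp add: R_def poly_prod pochhammer_prod lessThan_atLeast0 ac_simps)
    finally show ?thesis .
  qed
  then show thesis by (rule that)
qed

section \<open>First-order recurrences\<close>

lemma not_Ints_imp_not_dvd:
  fixes x :: rat
  assumes "x = of_int a / of_int N" "N > 0" "x \<notin> \<int>"
  shows "\<not> N dvd a"
proof
  assume "N dvd a"
  then have "x = of_int (a div N)" using assms(1) by (simp add: of_int_divide_in_Ints of_int_div)
  then show False using assms(3) by simp
qed

theorem theorem4p2:
  fixes a1 b0 b1 :: rat and s :: "nat \<Rightarrow> rat"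
  defines "S \<equiv> Abs_fps s"
  defines "conditions \<equiv>
       (b0 \<in> \<nat> \<and> b1 / a1 \<notin> \<int>)
     \<or> (b0 \<notin> \<int> \<and> b0 - b1 / a1 \<in> \<int>\<^sub>\<le>\<^sub>0)
     \<or> (b0 \<notin> \<int> \<and> b0 - b1 / a1 \<notin> \<int> \<and> b1 / a1 + 1 \<in> \<int>\<^sub>\<le>\<^sub>0)
     \<or> (b0 \<in> \<int> \<and> b1 / a1 \<in> \<int> \<and> b1 / a1 < 0 \<and> 0 < b0 \<and> b1 / a1 \<le> - 1)
     \<or> (b0 \<in> \<int> \<and> b1 / a1 \<in> \<int> \<and> 0 < b0 \<and> b0 \<le> b1 / a1)"
  assumes "a1 \<noteq> 0"
    and "b0 \<notin> {- of_nat k | k. k \<ge> 1}"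
    and "\<And>n. n \<ge> 1 \<Longrightarrow> (of_nat n + b0) * s n + (a1 * of_nat n + b1) * s (n - 1) = 0"
    and "S \<noteq> 0"
    and "\<not> (b0 = 0 \<and> b1 / a1 \<in> \<int>)"
  shows "(globally_bounded S \<longleftrightarrow> conditions) \<and>
         (globally_bounded S \<and> algebraic_fps S \<longleftrightarrow> conditions)"
proof -

  \<comment> \<open>Solution of the recurrence and convergence\<close>
  define \<beta> where "\<beta> = b1 / a1"
  have b1: "b1 = a1 * \<beta>" using \<open>a1 \<noteq> 0\<close> by (simp add: \<beta>_def)
  have nz: "b0 + 1 + of_nat k \<noteq> 0" for k
  proof
    assume "b0 + 1 + of_nat k = 0"
    then have "b0 = - of_nat (Suc k)" by (simp add: eq_neg_iff_add_eq_0 add_ac)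
    then have "b0 \<in> {- of_nat k | k. k \<ge> 1}" by (intro CollectI exI[of _ "Suc k"]) simp
    with assms(4) show False by contradiction
  qed
  have step: "s (Suc n) = - a1 * ((\<beta> + 1 + of_nat n) / (b0 + 1 + of_nat n)) * s n" for n
  proof -
    have "(b0 + 1 + of_nat n) * s (Suc n) + a1 * (\<beta> + 1 + of_nat n) * s n = 0"
      using assms(5)[of "Suc n"] by (simp add: b1 algebra_simps)
    then have "(b0 + 1 + of_nat n) * s (Suc n) = - a1 * (\<beta> + 1 + of_nat n) * s n"
      by (simp only: eq_neg_iff_add_eq_0 mult_minus_left)
    then show ?thesis using nz[of n] by (simp add: field_simps)
  qed
  have sol: "s n = s 0 * (- a1) ^ n * (\<Prod>k<n. (\<beta> + 1 + of_nat k) / (b0 + 1 + of_nat k))" for n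
    by (induction n) (simp_all add: step)
  have poch: "s n = s 0 * (- a1) ^ n * (pochhammer (\<beta> + 1) n / pochhammer (b0 + 1) n)" for n
    unfolding pochhammer_quotient[symmetric] by (rule sol)
  have s0: "s 0 \<noteq> 0"
  proof
    assume "s 0 = 0"
    then have "s n = 0" for n using sol[of n] by simp
    then show False using \<open>S \<noteq> 0\<close> by (simp add: S_def fps_eq_iff)
  qed
  \<comment> \<open>Ratios of consecutive terms are bounded, so convergence is automatic and global
    boundedness reduces to almost integrality.\<close>
  have "fps_conv_radius (Abs_fps (\<lambda>n. of_rat (fps_nth S n)) :: complex fps) > 0"
  proof -
    obtain K where K: "\<And>k. \<bar>(\<beta> + 1 + of_nat k) / (b0 + 1 + of_nat k)\<bar> \<le> K"
      using shifted_quotient_bounded[OF nz] by blast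
    have "\<bar>s (Suc n)\<bar> \<le> (\<bar>a1\<bar> * K) * \<bar>s n\<bar>" for n
      unfolding step abs_mult abs_minus_cancel by (intro mult_right_mono mult_left_mono K) auto
    then show ?thesis unfolding S_def by (rule conv_radius_pos_of_ratio_bound)
  qed
  then have bounded_iff: "globally_bounded S \<longleftrightarrow> almost_integral S"
    by (simp add: globally_bounded_def)

  \<comment> \<open>Sufficiency: terminating, rational and binomial series\<close>
  have finite: "almost_integral S \<and> algebraic_fps S" if "\<beta> + 1 = - of_nat j" for j
  proof -
    have "s n = 0" if n: "n \<ge> Suc j" for n
    proof -
      have "\<exists>k\<in>{..<n}. (\<beta> + 1 + of_nat k) / (b0 + 1 + of_nat k) = 0"
        using n by (intro bexI[of _ j]) (auto simp: \<open>\<beta> + 1 = - of_nat j\<close>)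
      then have "(\<Prod>k<n. (\<beta> + 1 + of_nat k) / (b0 + 1 + of_nat k)) = 0"
        by (intro prod_zero) auto
      then show ?thesis using sol[of n] by simp
    qed
    then show ?thesis
      using finite_support_almost_integral finite_support_algebraic unfolding S_def by blast
  qed
  have rational: "almost_integral S \<and> algebraic_fps S" if m: "\<beta> = b0 + of_nat m" for m
  proof -
    obtain R where R: "\<And>n. pochhammer (b0 + 1 + of_nat m) n / pochhammer (b0 + 1) n = poly R (of_nat n)"
      using pochhammer_quotient_poly[OF nz] by blast
    have \<beta>m: "\<beta> + 1 = b0 + 1 + of_nat m" by (simp add: m)
    have sR: "s n = poly ([:s 0:] * R) (of_nat n) * (- a1) ^ n" for n
      using poch[of n] unfolding \<beta>m R by simp
    have S: "S = Abs_fps (\<lambda>n. poly ([:s 0:] * R) (of_nat n) * (- a1) ^ n)"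
      unfolding S_def by (intro arg_cong[where f = Abs_fps] ext sR)
    obtain B E where "B \<noteq> 0" "fps_of_poly B * S = fps_of_poly E"
      using poly_times_power_rational unfolding S by blast
    then have "algebraic_fps S" by (rule algebraic_fps_rational)
    then show ?thesis using poly_times_power_almost_integral unfolding S by blast
  qed
  have binomial: "almost_integral S \<and> algebraic_fps S" if h: "b0 = of_nat h" "\<beta> \<notin> \<int>" for h
  proof -
    \<comment> \<open>With this \<open>\<delta>\<close>, the symbol of length \<open>n + h\<close>
      at \<open>\<delta>\<close> ends in the one of length \<open>n\<close> at
      \<open>\<beta> + 1\<close>, as \<open>fact (n + h)\<close> ends in the one at
      \<open>b0 + 1\<close>. So \<open>S\<close> is a shifted binomial series, and
      \<open>\<kappa>\<close> collects the constants.\<close>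
    define \<delta> where "\<delta> = \<beta> + 1 - of_nat h"
    define \<kappa> where "\<kappa> = s 0 * fact h / (pochhammer \<delta> h * (- a1) ^ h)"
    have \<delta>: "pochhammer \<delta> h \<noteq> 0"
    proof
      assume "pochhammer \<delta> h = 0"
      then obtain k where "\<delta> = - of_nat k" by (auto simp: pochhammer_eq_0_iff)
      then have "\<beta> = of_int (int h - int k - 1)" by (simp add: \<delta>_def algebra_simps)
      then show False using h(2) by (metis Ints_of_int)
    qed
    have "s n = \<kappa> * (pochhammer \<delta> (n + h) / fact (n + h) * (- a1) ^ (n + h))" for n
    proof -
      have 1: "pochhammer \<delta> (n + h) = pochhammer \<delta> h * pochhammer (\<beta> + 1) n"
        using pochhammer_product'[of \<delta> h n] by (simp add: \<delta>_def add.commute)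
      have 2: "(fact (n + h) :: rat) = fact h * pochhammer (b0 + 1) n"
        using pochhammer_product'[of "1 :: rat" h n] by (simp add: h pochhammer_fact add.commute)
      have "pochhammer (b0 + 1) n \<noteq> 0"
        using 2 by (metis fact_nonzero mult_zero_right)
      then show ?thesis
        unfolding 1 2 poch[of n] \<kappa>_def using \<delta> \<open>a1 \<noteq> 0\<close> by (simp add: power_add)
    qed
    moreover have "\<kappa> \<noteq> 0" using s0 \<delta> \<open>a1 \<noteq> 0\<close> by (simp add: \<kappa>_def)
    ultimately show ?thesis
      using binomial_shift_almost_integral binomial_shift_algebraic unfolding S_def by blast
  qed
  \<comment> \<open>Condition (1) is the binomial case, (2) and (5) make \<open>\<beta> - b0\<close>
    a natural number, (3) and (4) make \<open>\<beta> + 1\<close> a nonpositive integer.\<close>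
  have sufficient: "almost_integral S \<and> algebraic_fps S" if conditions
    using that unfolding conditions_def \<beta>_def[symmetric]
  proof (elim disjE conjE)
    assume "b0 \<in> \<nat>" "\<beta> \<notin> \<int>"
    then show ?thesis using binomial by (auto elim: Nats_cases)
  next
    assume "b0 - \<beta> \<in> \<int>\<^sub>\<le>\<^sub>0"
    then obtain m where "b0 - \<beta> = - of_nat m" by (rule nonpos_Ints_cases')
    then have "\<beta> = b0 + of_nat m" by (simp add: algebra_simps)
    then show ?thesis by (rule rational)
  next
    assume "\<beta> + 1 \<in> \<int>\<^sub>\<le>\<^sub>0"
    then show ?thesis using finite by (auto elim: nonpos_Ints_cases')
  next
    assume "\<beta> \<in> \<int>" "\<beta> \<le> - 1"
    then obtain z where z: "\<beta> = of_int z" "(of_int z :: rat) \<le> of_int (- 1)" by (auto elim: Ints_cases)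
    then have "z \<le> - 1" by (simp only: of_int_le_iff)
    then have "\<beta> + 1 = - of_nat (nat (- z - 1))" by (simp add: z)
    then show ?thesis by (rule finite)
  next
    assume "b0 \<in> \<int>" "\<beta> \<in> \<int>" "b0 \<le> \<beta>"
    then have "\<beta> - b0 \<in> \<int>" "\<beta> - b0 \<ge> 0" by simp_all
    then obtain z where z: "\<beta> - b0 = of_int z" "z \<ge> 0" by (auto elim: Ints_cases)
    then have "\<beta> = b0 + of_nat (nat z)" by (simp add: algebra_simps)
    then show ?thesis by (rule rational)
  qed

  \<comment> \<open>Necessity: unbounded primes in the denominators\<close>
  note not_integral = not_almost_integral_hypergeometric[OF _ _ _ s0 _ _ nz sol]
  have a1: "- a1 \<noteq> 0" using \<open>a1 \<noteq> 0\<close> by simp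
  obtain a' N' where ab: "\<beta> + 1 = of_int a' / of_int N'" "N' > 0"
    using quotient_of_div surj_pair quotient_of_denom_pos by metis
  obtain c' N'' where cb: "b0 + 1 = of_int c' / of_int N''" "N'' > 0"
    using quotient_of_div surj_pair quotient_of_denom_pos by metis
  \<comment> \<open>A common denominator turns both Pochhammer symbols into progressions of the same
    step \<open>N\<close>.\<close>
  define N a c where "N = N' * N''" and "a = a' * N''" and "c = c' * N'"
  have N: "N > 0" "\<beta> + 1 = of_int a / of_int N" "b0 + 1 = of_int c / of_int N"
    using ab cb by (simp_all add: N_def a_def c_def)
  have shift: "\<not> almost_integral S"
    if d: "b0 = \<beta> + of_nat d" "d \<ge> 1" and nz\<beta>: "\<And>k. \<beta> + 1 + of_nat k \<noteq> 0" for d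
  proof -
    have "b0 + 1 = \<beta> + 1 + of_nat d" using d(1) by simp
    then have "of_int c = (of_int (a + int d * N) :: rat)"
      using N by (simp add: field_simps)
    then have c: "c = a + int d * N" by (simp only: of_int_eq_iff)
    have "a + int k * N \<noteq> 0" for k
    proof
      assume "a + int k * N = 0"
      moreover have "\<beta> + 1 + of_nat k = of_int (a + int k * N) / of_int N"
        unfolding N(2) using N(1) by (simp add: add_divide_distrib)
      ultimately have "\<beta> + 1 + of_nat k = 0" by simp
      then show False using nz\<beta> by blast
    qed
    then show ?thesis unfolding S_def
      using not_integral[OF N a1 nz\<beta>] bad_primes_shift[OF N(1) d(2)] unfolding c by blast
  qed
  have pos_int: "\<not> almost_integral S" if A: "\<beta> + 1 = of_nat A" "A \<ge> 1" and b0: "b0 \<notin> \<int>" for A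
  proof -
    have "of_int a = (of_int (int A * N) :: rat)" using N(1) A(1) unfolding N(2) by (simp add: field_simps)
    then have a: "a = int A * N" by (simp only: of_int_eq_iff)
    have "b0 + 1 \<notin> \<int>" using b0 by simp
    then have c: "\<not> N dvd c" using not_Ints_imp_not_dvd N by blast
    have "\<beta> + 1 + of_nat k \<noteq> 0" for k
    proof -
      have "\<beta> + 1 + of_nat k = of_nat (A + k)" using A(1) by simp
      then show ?thesis using A(2) by (simp only: of_nat_eq_0_iff)
    qed
    then show ?thesis unfolding S_def
      using not_integral[OF N a1] bad_primes_pos_int[OF N(1) A(2) c] unfolding a by blast
  qed
  have fractional: "\<not> almost_integral S" if "b0 \<notin> \<int>" "\<beta> \<notin> \<int>" "b0 - \<beta> \<notin> \<int>"
  proof -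
    have "b0 + 1 \<notin> \<int>" "\<beta> + 1 \<notin> \<int>" using that by simp_all
    then have ac: "\<not> N dvd a" "\<not> N dvd c" using not_Ints_imp_not_dvd N by blast+
    have "\<beta> - b0 \<notin> \<int>" using that(3) by (metis Ints_minus minus_diff_eq)
    moreover have "\<beta> - b0 = of_int (a - c) / of_int N"
    proof -
      have "\<beta> - b0 = (\<beta> + 1) - (b0 + 1)" by simp
      then show ?thesis unfolding N by (simp add: diff_divide_distrib)
    qed
    ultimately have "\<not> N dvd a - c" using not_Ints_imp_not_dvd N(1) by blast
    note bad = bad_primes_fractional[OF N(1) ac this]
    have "\<beta> + 1 + of_nat k \<noteq> 0" for k
    proof
      assume "\<beta> + 1 + of_nat k = 0"
      then have "\<beta> = of_int (- 1 - int k)" by (simp add: algebra_simps eq_neg_iff_add_eq_0)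
      then show False using that(2) by (metis Ints_of_int)
    qed
    then show ?thesis unfolding S_def using not_integral[OF N a1] bad by blast
  qed
  \<comment> \<open>For integral \<open>b0\<close>, failure of all conditions leaves
    \<open>0 \<le> \<beta> < b0\<close>, a positive integral shift. For nonintegral
    \<open>b0\<close> there remain a positive integral \<open>b0 - \<beta>\<close>, a positive
    integral \<open>\<beta> + 1\<close>, and the fractional case.\<close>
  have necessary: "\<not> almost_integral S" if nc: "\<not> conditions"
  proof (cases "b0 \<in> \<int>")
    case True
    then obtain z where z: "b0 = of_int z" by (auto elim: Ints_cases)
    have "z \<ge> 0"
    proof (rule ccontr)
      assume "\<not> z \<ge> 0"
      then have "b0 + 1 + of_nat (nat (- z - 1)) = 0" by (simp add: z)
      then show False using nz by blast
    qed
    then have "b0 = of_nat (nat z)" using z by simp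
    then have "b0 \<in> \<nat>" by simp
    then have \<beta>: "\<beta> \<in> \<int>" using nc by (auto simp: conditions_def \<beta>_def)
    then obtain y where y: "\<beta> = of_int y" by (auto elim: Ints_cases)
    \<comment> \<open>For \<open>b0 = 0\<close> and integral \<open>\<beta>\<close> the series is a
      polynomial or rational although no condition holds; the last hypothesis excludes this.\<close>
    have "z \<noteq> 0" using assms(7) \<beta> by (auto simp: z \<beta>_def)
    then have "z > 0" using \<open>z \<ge> 0\<close> by simp
    have b0: "0 < b0" using \<open>z > 0\<close> by (simp add: z)
    have yz: "0 \<le> y" "y < z"
    proof -
      show "0 \<le> y"
      proof (rule ccontr)
        assume "\<not> 0 \<le> y"
        then have "\<beta> < 0" "(of_int y :: rat) \<le> of_int (- 1)" by (simp_all only: y of_int_less_0_iff of_int_le_iff)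
        then show False using nc True \<beta> b0 by (simp add: y conditions_def flip: \<beta>_def)
      qed
      show "y < z"
      proof (rule ccontr)
        assume "\<not> y < z"
        then have "b0 \<le> \<beta>" by (simp add: y z)
        then show False using nc True \<beta> b0 by (simp add: conditions_def flip: \<beta>_def)
      qed
    qed
    have "\<beta> + 1 + of_nat k \<noteq> 0" for k
    proof -
      have "\<beta> + 1 + of_nat k = of_int (y + 1 + int k)" by (simp add: y)
      then show ?thesis using yz(1) by (simp only: of_int_eq_0_iff)
    qed
    then show ?thesis using yz by (intro shift[of "nat (z - y)"]) (simp_all add: y z)
  next
    case b0: False
    show ?thesis
    proof (cases "b0 - \<beta> \<in> \<int>")
      case True
      then obtain z where z: "b0 - \<beta> = of_int z" by (auto elim: Ints_cases)
      have "\<not> z \<le> 0"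
      proof
        assume "z \<le> 0"
        then have "b0 - \<beta> \<in> \<int>\<^sub>\<le>\<^sub>0" by (auto simp: z nonpos_Ints_def)
        then show False using nc b0 by (simp add: conditions_def \<beta>_def)
      qed
      moreover have "b0 = \<beta> + of_int z" using z by (simp add: algebra_simps)
      \<comment> \<open>Otherwise \<open>\<beta>\<close>, and with it \<open>b0\<close>, would be an
        integer.\<close>
      moreover have "\<beta> + 1 + of_nat k \<noteq> 0" for k
      proof
        assume "\<beta> + 1 + of_nat k = 0"
        then have "b0 = of_int (z - 1 - int k)"
          using \<open>b0 = \<beta> + of_int z\<close> by (simp add: algebra_simps)
        then show False using b0 by (metis Ints_of_int)
      qed
      ultimately show ?thesis by (intro shift[of "nat z"]) simp_all
    next
      case b0\<beta>: False
      show ?thesis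
      proof (cases "\<beta> \<in> \<int>")
        case True
        then obtain y where y: "\<beta> = of_int y" by (auto elim: Ints_cases)
        have "y + 1 > 0"
        proof (rule ccontr)
          assume "\<not> y + 1 > 0"
          moreover have "\<beta> + 1 = of_int (y + 1)" by (simp add: y)
          ultimately have "\<beta> + 1 \<in> \<int>\<^sub>\<le>\<^sub>0" by (simp only: of_int_in_nonpos_Ints_iff not_less)
          then show False using nc b0 b0\<beta> by (simp add: conditions_def \<beta>_def)
        qed
        then show ?thesis by (intro pos_int[of "nat (y + 1)"] b0) (simp_all add: y)
      next
        case False
        then show ?thesis using fractional b0 b0\<beta> by blast
      qed
    qed
  qed
  show ?thesis using bounded_iff sufficient necessary by blast
qed

end
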